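(* Let $n\ge 2$ be even. For any estimation procedure $\hat\mu_{n/2}$ of the treatment effect $\mu^*$ (applied separately to each half of the data, as described in the context), the resulting two-stage cross-fitted estimator $\hat\tau_n$ satisfies $$\mathbb{E}\big[|\hat\tau_n-\tau^*|^2\big]\;\le\;\frac1n\Big\{v_*^2+2\,\mathbb{E}\big[\|\hat\mu_{n/2}-\mu^*\|_\omega^2\big]\Big\}.$$
   Context: Setting. $\mathbb X$ is a state space, $\mathbb A$ an action space with base measure $\lambda$, and outcomes are real-valued. For each $x\in\mathbb X$, $\pi(x,\cdot)$ is a known probability density on $\mathbb A$ with respect to $\lambda$, and $g:\mathbb X\times\mathbb A\to\mathbb R$ is a known weight function; $\pi>0$, so that ratios such as $g/\pi$ make sense. $\xi^*$ is a probability distribution on $\mathbb X$. One observes i.i.d. triples $(X_i,A_i,Y_i)$, $i=1,\dots,n$, with $X_i\sim\xi^*$, $A_i\mid X_i\sim\pi(X_i,\cdot)$, $\mathbb E[Y_i\mid X_i,A_i]=\mu^*(X_i,A_i)$, and conditional variance $\sigma^2(x,a)=\mathbb E[(Y-\mu^*(X,A))^2\mid X=x,A=a]$, assumed to exist. Notation. $\langle h_1,h_2\rangle_\lambda=\int_{\mathbb A}h_1(a)h_2(a)\,d\lambda(a)$. Target: $\tau^*=\int_{\mathbb A}\mathbb E_{\xi^*}[g(X,a)\mu^*(X,a)]\,d\lambda(a)$. Weighted norm: $\|h\|_\omega^2=\int_{\mathbb A}\mathbb E_{\xi^*}\big[\frac{g^2(X,a)}{\pi(X,a)}h^2(X,a)\big]d\lambda(a)$.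 Efficient variance: $v_*^2=\mathrm{var}_{\xi^*}\big(\langle g(X,\cdot),\mu^*(X,\cdot)\rangle_\lambda\big)+\int_{\mathbb A}\mathbb E_{\xi^*}\big[\frac{g^2(X,a)}{\pi(X,a)}\sigma^2(X,a)\big]d\lambda(a)$. Two-stage estimator. Split the data into $B_1=(X_i,A_i,Y_i)_{i=1}^{n/2}$ and $B_2=(X_i,A_i,Y_i)_{i=n/2+1}^{n}$. For $j\in\{1,2\}$, let $\hat\mu^{(j)}_{n/2}:\mathbb X\times\mathbb A\to\mathbb R$ be the output of the (arbitrary) estimation procedure applied to $B_j$ (so both have the same distribution, that of $\hat\mu_{n/2}$), and set $$\hat f^{(j)}_{n/2}(x,a)=\frac{g(x,a)\hat\mu^{(j)}_{n/2}(x,a)}{\pi(x,a)}-\langle g(x,\cdot),\hat\mu^{(j)}_{n/2}(x,\cdot)\rangle_\lambda .$$ Then $$\hat\tau_n=\frac1n\sum_{i=1}^{n/2}\Big\{\frac{g(X_i,A_i)}{\pi(X_i,A_i)}Y_i-\hat f^{(2)}_{n/2}(X_i,A_i)\Big\}+\frac1n\sum_{i=n/2+1}^{n}\Big\{\frac{g(X_i,A_i)}{\pi(X_i,A_i)}Y_i-\hat f^{(1)}_{n/2}(X_i,A_i)\Big\}.$$ *)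

theory Defs
  imports "HOL-Probability.Probability"
begin

definition inner_lam :: "'a measure \<Rightarrow> ('a \<Rightarrow> real) \<Rightarrow> ('a \<Rightarrow> real) \<Rightarrow> real" where
  "inner_lam lam h1 h2 = (LINT a|lam. h1 a * h2 a)"

definition target :: "'x measure \<Rightarrow> 'a measure \<Rightarrow> ('x \<Rightarrow> 'a \<Rightarrow> real) \<Rightarrow> ('x \<Rightarrow> 'a \<Rightarrow> real) \<Rightarrow> real" where
  "target xi lam g mu = (LINT a|lam. (LINT x|xi. g x a * mu x a))"

text \<open>
  Squared norms, variances and mean squared errors take values in \<open>[0, \<infinity>]\<close>. They are therefore
  nonnegative integrals: the Bochner integral, and with it \<^const>\<open>prob_space.variance\<close>,
  would be \<open>0\<close> where the intended value is \<open>\<infinity>\<close>.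
\<close>

definition weighted_norm_sq ::
    "'x measure \<Rightarrow> 'a measure \<Rightarrow> ('x \<Rightarrow> 'a \<Rightarrow> real) \<Rightarrow> ('x \<Rightarrow> 'a \<Rightarrow> real) \<Rightarrow> ('x \<Rightarrow> 'a \<Rightarrow> real) \<Rightarrow> ennreal" where
  "weighted_norm_sq xi lam p g h =
     (\<integral>\<^sup>+ a. (\<integral>\<^sup>+ x. ennreal ((g x a)\<^sup>2 / p x a * (h x a)\<^sup>2) \<partial>xi) \<partial>lam)"

definition ext_variance :: "'x measure \<Rightarrow> ('x \<Rightarrow> real) \<Rightarrow> ennreal" where
  "ext_variance M f = (\<integral>\<^sup>+ x. ennreal ((f x - (LINT x'|M. f x'))\<^sup>2) \<partial>M)"

definition efficient_variance ::
    "'x measure \<Rightarrow> 'a measure \<Rightarrow> ('x \<Rightarrow> 'a \<Rightarrow> real) \<Rightarrow> ('x \<Rightarrow> 'a \<Rightarrow> real) \<Rightarrow>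
     ('x \<Rightarrow> 'a \<Rightarrow> real) \<Rightarrow> ('x \<Rightarrow> 'a \<Rightarrow> real) \<Rightarrow> ennreal" where
  "efficient_variance xi lam p g mu sigma2 =
     ext_variance xi (\<lambda>x. inner_lam lam (g x) (mu x)) +
     (\<integral>\<^sup>+ a. (\<integral>\<^sup>+ x. ennreal ((g x a)\<^sup>2 / p x a * sigma2 x a) \<partial>xi) \<partial>lam)"

abbreviation obs_space :: "'x measure \<Rightarrow> 'a measure \<Rightarrow> ('x \<times> 'a \<times> real) measure" where
  "obs_space xi lam \<equiv> xi \<Otimes>\<^sub>M (lam \<Otimes>\<^sub>M borel)"

text \<open>
  The conditional law of one observation \<open>(X, A, Y)\<close>. Since every \<open>p x\<close> integrates to \<open>1\<close>,
  the joint density \<open>p\<close> of \<open>(X, A)\<close> with respect to \<open>xi \<Otimes> lam\<close> says that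
  \<open>X\<close> has law \<open>xi\<close> and that \<open>A\<close> given \<open>X = x\<close> has density \<open>p x\<close>.
  The conditional variance is the conditional expectation of a nonnegative function, so it
  makes sense, and may be finite, without \<open>Y\<close> being square integrable.
\<close>

definition observation_model ::
    "'w measure \<Rightarrow> 'x measure \<Rightarrow> 'a measure \<Rightarrow> ('x \<Rightarrow> 'a \<Rightarrow> real) \<Rightarrow> ('x \<Rightarrow> 'a \<Rightarrow> real) \<Rightarrow>
     ('x \<Rightarrow> 'a \<Rightarrow> real) \<Rightarrow> ('w \<Rightarrow> 'x) \<Rightarrow> ('w \<Rightarrow> 'a) \<Rightarrow> ('w \<Rightarrow> real) \<Rightarrow> bool" where
  "observation_model M xi lam p mu sigma2 X A Y \<longleftrightarrow>
     distributed M (xi \<Otimes>\<^sub>M lam) (\<lambda>\<omega>. (X \<omega>, A \<omega>)) (\<lambda>(x, a). ennreal (p x a)) \<and>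
     integrable M Y \<and>
     (let F = vimage_algebra (space M) (\<lambda>\<omega>. (X \<omega>, A \<omega>)) (xi \<Otimes>\<^sub>M lam) in
       (AE \<omega> in M. real_cond_exp M F Y \<omega> = mu (X \<omega>) (A \<omega>)) \<and>
       (AE \<omega> in M. nn_cond_exp M F (\<lambda>\<omega>. ennreal ((Y \<omega> - mu (X \<omega>) (A \<omega>))\<^sup>2)) \<omega> =
                     ennreal (sigma2 (X \<omega>) (A \<omega>))))"

text \<open>
  An estimation procedure maps a sample of size \<open>m\<close>, indexed by \<open>{1..m}\<close>, to a function of state
  and action.
\<close>

definition estimation_procedure ::
    "'x measure \<Rightarrow> 'a measure \<Rightarrow> nat \<Rightarrow> ((nat \<Rightarrow> 'x \<times> 'a \<times> real) \<Rightarrow> 'x \<Rightarrow> 'a \<Rightarrow> real) \<Rightarrow> bool" where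
  "estimation_procedure xi lam m est \<longleftrightarrow>
     (\<lambda>(d, x, a). est d x a)
       \<in> borel_measurable ((\<Pi>\<^sub>M i\<in>{1..m}. obs_space xi lam) \<Otimes>\<^sub>M (xi \<Otimes>\<^sub>M lam))"

text \<open>
  For a sample \<open>z\<close> indexed by \<open>{1..n}\<close>, both halves are reindexed by \<open>{1..n div 2}\<close>, so that the
  same procedure applies to each.
\<close>

definition half1 :: "nat \<Rightarrow> (nat \<Rightarrow> 'z) \<Rightarrow> nat \<Rightarrow> 'z" where
  "half1 n z = (\<lambda>i\<in>{1..n div 2}. z i)"

definition half2 :: "nat \<Rightarrow> (nat \<Rightarrow> 'z) \<Rightarrow> nat \<Rightarrow> 'z" where
  "half2 n z = (\<lambda>i\<in>{1..n div 2}. z (n div 2 + i))"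

definition f_hat ::
    "'a measure \<Rightarrow> ('x \<Rightarrow> 'a \<Rightarrow> real) \<Rightarrow> ('x \<Rightarrow> 'a \<Rightarrow> real) \<Rightarrow> ('x \<Rightarrow> 'a \<Rightarrow> real) \<Rightarrow> 'x \<Rightarrow> 'a \<Rightarrow> real" where
  "f_hat lam p g m x a = g x a * m x a / p x a - inner_lam lam (g x) (m x)"

definition tau_hat ::
    "'a measure \<Rightarrow> ('x \<Rightarrow> 'a \<Rightarrow> real) \<Rightarrow> ('x \<Rightarrow> 'a \<Rightarrow> real) \<Rightarrow>
     ((nat \<Rightarrow> 'x \<times> 'a \<times> real) \<Rightarrow> 'x \<Rightarrow> 'a \<Rightarrow> real) \<Rightarrow> nat \<Rightarrow> (nat \<Rightarrow> 'x \<times> 'a \<times> real) \<Rightarrow> real" where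
  "tau_hat lam p g est n z =
     1 / real n * (\<Sum>i\<in>{1..n div 2}.
       (case z i of (x, a, y) \<Rightarrow> g x a / p x a * y - f_hat lam p g (est (half2 n z)) x a)) +
     1 / real n * (\<Sum>i\<in>{n div 2 + 1..n}.
       (case z i of (x, a, y) \<Rightarrow> g x a / p x a * y - f_hat lam p g (est (half1 n z)) x a))"

end

theory Submission imports Defs begin

text \<open>
  Put \<open>s(x,a,y) = g(x,a) (y - \<mu>(x,a)) / \<pi>(x,a) + \<langle>g(x,\<cdot>), \<mu>(x,\<cdot>)\<rangle> - \<tau>\<close> and let \<open>v\<^sub>h\<close> be
  the difference of the functions \<open>f\<close> associated with \<open>h\<close> and with \<open>\<mu>\<close>. Up to the factor \<open>1/n\<close>,
  the error of the estimator is exactly the sum of \<open>s\<close> over all observations minus, for each half,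
  the sum of \<open>v\<^sub>h\<close> with \<open>h\<close> estimated on the other half. The score \<open>s\<close> is centered with second
  moment the efficient variance. For fixed \<open>h\<close>, the correction \<open>v\<^sub>h\<close> has conditional mean \<open>0\<close> given
  \<open>X\<close>, so it is centered and orthogonal to \<open>s\<close>, and its second moment is at most the squared
  weighted norm of \<open>h - \<mu>\<close>. Conditioning on one half at a time shows that the score sum is
  orthogonal to both correction sums. The two correction sums may be correlated with each other,
  and \<open>(t + t')\<^sup>2 \<le> 2 t\<^sup>2 + 2 t'\<^sup>2\<close> produces the factor \<open>2\<close>.
\<close>

section \<open>Second moments of i.i.d. sums and of cross-fitted sums\<close>

lemma integrable_mult_of_squares:
  fixes f g :: "'a \<Rightarrow> real"
  assumes [measurable]: "f \<in> borel_measurable M" "g \<in> borel_measurable M"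
    and "integrable M (\<lambda>x. (f x)\<^sup>2)" "integrable M (\<lambda>x. (g x)\<^sup>2)"
  shows "integrable M (\<lambda>x. f x * g x)"
proof (rule Bochner_Integration.integrable_bound)
  show "integrable M (\<lambda>x. (f x)\<^sup>2 + (g x)\<^sup>2)"
    using assms by simp
  have "\<bar>a * b\<bar> \<le> a\<^sup>2 + b\<^sup>2" for a b :: real
    using sum_squares_bound[of a b] sum_squares_bound[of a "-b"] by (simp add: abs_if)
  then show "AE x in M. norm (f x * g x) \<le> norm ((f x)\<^sup>2 + (g x)\<^sup>2)"
    by (auto simp: abs_of_nonneg)
qed simp

lemma integrable_square_add:
  fixes f g :: "'a \<Rightarrow> real"
  assumes "f \<in> borel_measurable M" "g \<in> borel_measurable M"
    and "integrable M (\<lambda>x. (f x)\<^sup>2)" "integrable M (\<lambda>x. (g x)\<^sup>2)"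
  shows "integrable M (\<lambda>x. (f x + g x)\<^sup>2)"
proof -
  have "(\<lambda>x. (f x + g x)\<^sup>2) = (\<lambda>x. (f x)\<^sup>2 + (g x)\<^sup>2 + 2 * (f x * g x))"
    by (simp add: power2_sum mult.assoc)
  then show ?thesis
    using assms integrable_mult_of_squares[OF assms] by simp
qed

lemma integral_square_add_orthogonal:
  fixes f g :: "'a \<Rightarrow> real"
  assumes "f \<in> borel_measurable M" "g \<in> borel_measurable M"
    and "integrable M (\<lambda>x. (f x)\<^sup>2)" "integrable M (\<lambda>x. (g x)\<^sup>2)"
    and "(\<integral>x. f x * g x \<partial>M) = 0"
  shows "(\<integral>x. (f x + g x)\<^sup>2 \<partial>M) = (\<integral>x. (f x)\<^sup>2 \<partial>M) + (\<integral>x. (g x)\<^sup>2 \<partial>M)"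
proof -
  have "(\<lambda>x. (f x + g x)\<^sup>2) = (\<lambda>x. (f x)\<^sup>2 + (g x)\<^sup>2 + 2 * (f x * g x))"
    by (simp add: power2_sum mult.assoc)
  then show ?thesis
    using assms integrable_mult_of_squares[OF assms(1-4)] by simp
qed

lemma integrable_square_iff:
  fixes f :: "'a \<Rightarrow> real"
  assumes "f \<in> borel_measurable M"
  shows "integrable M (\<lambda>x. (f x)\<^sup>2) \<longleftrightarrow> (\<integral>\<^sup>+x. ennreal ((f x)\<^sup>2) \<partial>M) < \<infinity>"
  using assms by (subst integrable_iff_bounded) simp

text \<open>Expanding the product of the two sums gives a double sum over pairs of coordinates. The
  coordinates are independent and \<open>u\<close> is centered, so the off-diagonal terms vanish and
  only \<open>card I\<close> equal diagonal terms remain.\<close>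

lemma
  fixes u w :: "'a \<Rightarrow> real"
  assumes "prob_space Q" "finite I"
    and meas: "u \<in> borel_measurable Q" "w \<in> borel_measurable Q"
    and sq: "integrable Q (\<lambda>z. (u z)\<^sup>2)" "integrable Q (\<lambda>z. (w z)\<^sup>2)"
    and zero: "(\<integral>z. u z \<partial>Q) = 0"
  shows integral_PiM_sum_centered: "(\<integral>d. (\<Sum>i\<in>I. u (d i)) \<partial>PiM I (\<lambda>_. Q)) = 0"
    and integral_PiM_sum_mult:
      "(\<integral>d. (\<Sum>i\<in>I. u (d i)) * (\<Sum>i\<in>I. w (d i)) \<partial>PiM I (\<lambda>_. Q)) = card I * (\<integral>z. u z * w z \<partial>Q)"
    and integrable_PiM_sum_square: "integrable (PiM I (\<lambda>_. Q)) (\<lambda>d. (\<Sum>i\<in>I. u (d i))\<^sup>2)"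
proof -
  interpret Q: prob_space Q by fact
  interpret PP: product_prob_space "\<lambda>_. Q" I by unfold_locales
  let ?R = "PiM I (\<lambda>_. Q)"
  note [measurable] = meas
  have comp: "integrable ?R (\<lambda>d. h (d i)) \<and> (\<integral>d. h (d i) \<partial>?R) = (\<integral>z. h z \<partial>Q)"
    if "i \<in> I" "integrable Q h" for i and h :: "'a \<Rightarrow> real"
    using that PP.PiM_component[OF that(1)]
      integrable_distr_eq[of "\<lambda>d. d i" ?R Q h] integral_distr[of "\<lambda>d. d i" ?R Q h]
    by (simp add: measurable_component_singleton)
  have intu: "integrable Q u" and intw: "integrable Q w"
    using Q.square_integrable_imp_integrable[OF meas(1) sq(1)]
      Q.square_integrable_imp_integrable[OF meas(2) sq(2)] by auto
  show "(\<integral>d. (\<Sum>i\<in>I. u (d i)) \<partial>?R) = 0"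
    using comp[OF _ intu] zero by simp
  have prods: "integrable ?R (\<lambda>d. f (d i) * h (d j)) \<and>
      (\<integral>d. f (d i) * h (d j) \<partial>?R) = (if i = j then \<integral>z. f z * h z \<partial>Q else 0)"
    if ij: "i \<in> I" "j \<in> I" and "f = u" "h = u \<or> h = w" for i j f h
  proof (cases "i = j")
    case True
    then show ?thesis
      using comp[OF ij(1), of "\<lambda>z. f z * h z"] that integrable_mult_of_squares[of _ Q] meas sq
      by auto
  next
    case False
    \<comment> \<open>The off-diagonal term becomes a product over all of \<open>I\<close>, with the
      constant 1 at the other coordinates, so that the product formula for integrals applies. Its
      factor at \<open>i\<close> is the mean of \<open>u\<close>, which is 0.\<close>
    define k where "k l = (if l = i then f else if l = j then h else (\<lambda>_. 1))" for l
    have intk: "integrable Q (k l)" for l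
      using intu intw that by (auto simp: k_def)
    have eq: "(\<Prod>l\<in>I. k l (d l)) = f (d i) * h (d j)" for d
    proof -
      have "(\<Prod>l\<in>I. k l (d l)) = (\<Prod>l\<in>{i, j}. k l (d l))"
        by (rule prod.mono_neutral_right) (use ij \<open>finite I\<close> in \<open>auto simp: k_def\<close>)
      then show ?thesis
        using False by (simp add: k_def)
    qed
    have "(\<Prod>l\<in>I. integral\<^sup>L Q (k l)) = 0"
      using ij zero \<open>f = u\<close> \<open>finite I\<close> by (auto simp: k_def intro!: prod_zero bexI[of _ i])
    then show ?thesis
      using False PP.product_integrable_prod[of I k, OF \<open>finite I\<close> intk]
        PP.product_integral_prod[of I k, OF \<open>finite I\<close> intk] by (simp add: eq)
  qed
  show "(\<integral>d. (\<Sum>i\<in>I. u (d i)) * (\<Sum>i\<in>I. w (d i)) \<partial>?R) = card I * (\<integral>z. u z * w z \<partial>Q)"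
    using prods[THEN conjunct1, of _ _ u w] prods[THEN conjunct2, of _ _ u w] \<open>finite I\<close>
    by (simp add: sum_product Bochner_Integration.integral_sum sum.delta)
  show "integrable ?R (\<lambda>d. (\<Sum>i\<in>I. u (d i))\<^sup>2)"
    using prods[THEN conjunct1, of _ _ u u] by (simp add: power2_eq_square sum_product)
qed

text \<open>This is the probabilistic core, free of the statistical model: \<open>v d\<close> stands
  for the correction computed from the sample \<open>d\<close>. Its properties are asked for almost
  every \<open>d\<close> only, because a finite expected norm yields no more than that.\<close>

lemma crossfit_second_moment:
  fixes s :: "'a \<Rightarrow> real" and v :: "('i \<Rightarrow> 'a) \<Rightarrow> 'a \<Rightarrow> real"
  assumes Q: "prob_space Q" and I: "finite I"
    and s: "s \<in> borel_measurable Q" "integrable Q (\<lambda>z. (s z)\<^sup>2)" "(\<integral>z. s z \<partial>Q) = 0"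
    and v[measurable]: "case_prod v \<in> borel_measurable (PiM I (\<lambda>_. Q) \<Otimes>\<^sub>M Q)"
    and v0: "AE d in PiM I (\<lambda>_. Q). integrable Q (\<lambda>z. (v d z)\<^sup>2) \<and>
       (\<integral>z. v d z \<partial>Q) = 0 \<and> (\<integral>z. s z * v d z \<partial>Q) = 0"
  shows "(\<integral>\<^sup>+(d1, d2). ennreal (((\<Sum>i\<in>I. s (d1 i)) + (\<Sum>i\<in>I. s (d2 i))
             - (\<Sum>i\<in>I. v d2 (d1 i)) - (\<Sum>i\<in>I. v d1 (d2 i)))\<^sup>2) \<partial>(PiM I (\<lambda>_. Q) \<Otimes>\<^sub>M PiM I (\<lambda>_. Q)))
         \<le> ennreal (2 * card I) * ennreal (\<integral>z. (s z)\<^sup>2 \<partial>Q)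
           + ennreal (4 * card I) * (\<integral>\<^sup>+d. \<integral>\<^sup>+z. ennreal ((v d z)\<^sup>2) \<partial>Q \<partial>PiM I (\<lambda>_. Q))"
proof -
  interpret Q: prob_space Q by fact
  interpret PP: product_prob_space "\<lambda>_. Q" I by unfold_locales
  define R where "R = PiM I (\<lambda>_. Q)"
  interpret R: prob_space R unfolding R_def by (rule prob_space_PiM) (rule Q)
  interpret RR: pair_prob_space R R by unfold_locales
  note v = v[folded R_def] and v0 = v0[folded R_def]
  note [measurable] = s(1) v
  define b where "b = (\<integral>\<^sup>+d. \<integral>\<^sup>+z. ennreal ((v d z)\<^sup>2) \<partial>Q \<partial>R)"
  define S where "S d = (\<Sum>i\<in>I. s (d i))" for d
  define T where "T d' d = (\<Sum>i\<in>I. v d' (d i))" for d' d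
  have comp[measurable]: "i \<in> I \<Longrightarrow> (\<lambda>d. d i) \<in> measurable R Q" for i
    unfolding R_def by simp
  have S_meas[measurable]: "S \<in> borel_measurable R"
    unfolding S_def[abs_def] by measurable
  have T_meas[measurable]: "case_prod T \<in> borel_measurable (R \<Otimes>\<^sub>M R)"
    unfolding T_def[abs_def] by measurable
  have v_sec[measurable]: "d \<in> space R \<Longrightarrow> v d \<in> borel_measurable Q" for d
    by measurable
  have S_sq: "integrable R (\<lambda>d. (S d)\<^sup>2)" and S_0: "integral\<^sup>L R S = 0"
    and S_int: "(\<integral>d. (S d)\<^sup>2 \<partial>R) = card I * (\<integral>z. (s z)\<^sup>2 \<partial>Q)"
    using integrable_PiM_sum_square[OF Q I s(1) s(1) s(2) s(2) s(3)]
      integral_PiM_sum_centered[OF Q I s(1) s(1) s(2) s(2) s(3)]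
      integral_PiM_sum_mult[OF Q I s(1) s(1) s(2) s(2) s(3)]
    by (simp_all add: R_def S_def[abs_def] power2_eq_square)
  show ?thesis
  \<comment> \<open>If \<open>b\<close> is infinite, so is the right-hand side, provided that
    \<open>card I\<close> is positive. The empty index set is set apart because zero times infinity
    is 0; there the left-hand side is 0 as well.\<close>
  proof (cases "b < \<infinity> \<and> I \<noteq> {}")
    case False
    then consider "I = {}" | "I \<noteq> {}" "b = \<infinity>" by (auto simp: less_top[symmetric])
    then show ?thesis
    proof cases
      case 2
      then have "ennreal (4 * card I) * b = \<infinity>"
        using I by (simp add: ennreal_mult_top card_gt_0_iff)
      then show ?thesis unfolding b_def R_def by simp
    qed (simp add: split_beta')
  next
    case True
    \<comment> \<open>For fixed \<open>d\<close> the estimate no longer varies, so the rules for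
      i.i.d. sums apply to \<open>v d\<close>, and to the pair of \<open>s\<close> and
      \<open>v d\<close> for the mixed moment.\<close>
    have T_good: "integral\<^sup>L R (T d) = 0" "(\<integral>e. S e * T d e \<partial>R) = 0"
      "integrable R (\<lambda>e. (T d e)\<^sup>2)" "(\<integral>e. (T d e)\<^sup>2 \<partial>R) = card I * (\<integral>z. (v d z)\<^sup>2 \<partial>Q)"
      if d: "d \<in> space R" "integrable Q (\<lambda>z. (v d z)\<^sup>2)"
        and d0: "(\<integral>z. v d z \<partial>Q) = 0" "(\<integral>z. s z * v d z \<partial>Q) = 0" for d
      using integrable_PiM_sum_square[OF Q I v_sec v_sec, OF d(1,1,2,2) d0(1)]
        integral_PiM_sum_centered[OF Q I v_sec v_sec, OF d(1,1,2,2) d0(1)]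
        integral_PiM_sum_mult[OF Q I v_sec v_sec, OF d(1,1,2,2) d0(1)]
        integral_PiM_sum_mult[OF Q I s(1) v_sec s(2) _ s(3), OF d(1,2)]
        d0
      by (simp_all add: R_def S_def[abs_def] T_def[abs_def] power2_eq_square)
    have T_nn: "(\<integral>\<^sup>+x. ennreal ((case_prod T x)\<^sup>2) \<partial>(R \<Otimes>\<^sub>M R)) = ennreal (card I) * b"
    proof -
      have "(\<integral>\<^sup>+x. ennreal ((case_prod T x)\<^sup>2) \<partial>(R \<Otimes>\<^sub>M R)) = (\<integral>\<^sup>+d. \<integral>\<^sup>+e. ennreal ((T d e)\<^sup>2) \<partial>R \<partial>R)"
        by (subst R.nn_integral_fst[symmetric]) simp_all
      also have "\<dots> = (\<integral>\<^sup>+d. ennreal (card I) * (\<integral>\<^sup>+z. ennreal ((v d z)\<^sup>2) \<partial>Q) \<partial>R)"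
      proof (rule nn_integral_cong_AE, use v0 AE_space in eventually_elim, goal_cases)
        case (1 d)
        then have d: "d \<in> space R" "integrable Q (\<lambda>z. (v d z)\<^sup>2)"
          "(\<integral>z. v d z \<partial>Q) = 0" "(\<integral>z. s z * v d z \<partial>Q) = 0" by auto
        have "(\<integral>\<^sup>+e. ennreal ((T d e)\<^sup>2) \<partial>R) = ennreal (card I * (\<integral>z. (v d z)\<^sup>2 \<partial>Q))"
          using T_good[OF d] by (subst nn_integral_eq_integral) auto
        also have "\<dots> = ennreal (card I) * (\<integral>\<^sup>+z. ennreal ((v d z)\<^sup>2) \<partial>Q)"
          using d by (subst nn_integral_eq_integral) (auto simp: ennreal_mult)
        finally show ?case .
      qed
      also have "\<dots> = ennreal (card I) * b"
        unfolding b_def by (rule nn_integral_cmult) measurable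
      finally show ?thesis .
    qed
    have T_sq: "integrable (R \<Otimes>\<^sub>M R) (\<lambda>x. (case_prod T x)\<^sup>2)"
      using True by (subst integrable_square_iff) (auto simp: T_nn ennreal_mult_less_top)
    define A where "A x = S (fst x) + S (snd x)" for x
    have [measurable]: "A \<in> borel_measurable (R \<Otimes>\<^sub>M R)"
      unfolding A_def[abs_def] by measurable
    have fst_sq: "integrable (R \<Otimes>\<^sub>M R) (\<lambda>x. (S (fst x))\<^sup>2)"
        "(\<integral>x. (S (fst x))\<^sup>2 \<partial>(R \<Otimes>\<^sub>M R)) = (\<integral>d. (S d)\<^sup>2 \<partial>R)"
      using S_sq R.distr_pair_fst[of R] R.prob_space_axioms
        integrable_distr_eq[of fst "R \<Otimes>\<^sub>M R" R "\<lambda>d. (S d)\<^sup>2"]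
        integral_distr[of fst "R \<Otimes>\<^sub>M R" R "\<lambda>d. (S d)\<^sup>2"] by simp_all
    have snd_sq: "integrable (R \<Otimes>\<^sub>M R) (\<lambda>x. (S (snd x))\<^sup>2)"
        "(\<integral>x. (S (snd x))\<^sup>2 \<partial>(R \<Otimes>\<^sub>M R)) = (\<integral>d. (S d)\<^sup>2 \<partial>R)"
      using fst_sq RR.integrable_product_swap[of "\<lambda>x. (S (fst x))\<^sup>2"]
        RR.integral_product_swap[of "\<lambda>x. (S (fst x))\<^sup>2"] by (simp_all add: split_beta')
    have "(\<integral>x. S (fst x) * S (snd x) \<partial>(R \<Otimes>\<^sub>M R)) = (\<integral>d. \<integral>e. S d * S e \<partial>R \<partial>R)"
      using fst_sq snd_sq by (subst RR.integral_fst'[symmetric]) (auto intro!: integrable_mult_of_squares)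
    then have "(\<integral>x. S (fst x) * S (snd x) \<partial>(R \<Otimes>\<^sub>M R)) = 0"
      by (simp add: S_0)
    then have A_sq: "integrable (R \<Otimes>\<^sub>M R) (\<lambda>x. (A x)\<^sup>2)"
        "(\<integral>x. (A x)\<^sup>2 \<partial>(R \<Otimes>\<^sub>M R)) = 2 * card I * (\<integral>z. (s z)\<^sup>2 \<partial>Q)"
      using fst_sq snd_sq integrable_square_add[of "\<lambda>x. S (fst x)" "R \<Otimes>\<^sub>M R" "\<lambda>x. S (snd x)"]
        integral_square_add_orthogonal[of "\<lambda>x. S (fst x)" "R \<Otimes>\<^sub>M R" "\<lambda>x. S (snd x)"]
      by (simp_all add: A_def S_int)
    have AT_int: "integrable (R \<Otimes>\<^sub>M R) (\<lambda>x. A x * case_prod T x)"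
      using A_sq T_sq by (intro integrable_mult_of_squares) simp_all
    \<comment> \<open>Given the half \<open>d\<close> that fixes the estimate, \<open>T d\<close> is a centered i.i.d. sum over the other half.\<close>
    have AT_0: "(\<integral>x. A x * case_prod T x \<partial>(R \<Otimes>\<^sub>M R)) = 0"
    proof -
      have "AE d in R. (\<integral>e. A (d, e) * T d e \<partial>R) = 0"
        using v0 AE_space
      proof eventually_elim
        case (elim d)
        then have d: "d \<in> space R" "integrable Q (\<lambda>z. (v d z)\<^sup>2)"
          "(\<integral>z. v d z \<partial>Q) = 0" "(\<integral>z. s z * v d z \<partial>Q) = 0" by auto
        have [measurable]: "T d \<in> borel_measurable R"
          using T_meas elim by measurable
        have "integrable R (T d)" "integrable R (\<lambda>e. S e * T d e)"
          using T_good[OF d] S_sq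
          by (auto intro: R.square_integrable_imp_integrable integrable_mult_of_squares)
        then show ?case
          using T_good[OF d] by (simp add: A_def distrib_right)
      qed
      then have "(\<integral>d. \<integral>e. A (d, e) * T d e \<partial>R \<partial>R) = 0"
        by (rule integral_eq_zero_AE)
      then show ?thesis
        using RR.integral_fst'[OF AT_int] by simp
    qed
    \<comment> \<open>\<open>T'\<close> is \<open>T\<close> with the two halves exchanged. The
      exchange preserves the product measure and leaves \<open>A\<close> unchanged, so the facts
      about \<open>T\<close> carry over.\<close>
    define T' where "T' x = T (snd x) (fst x)" for x
    have [measurable]: "T' \<in> borel_measurable (R \<Otimes>\<^sub>M R)"
      unfolding T'_def[abs_def] by measurable
    have A_swap: "A (snd x, fst x) = A x" for x
      by (simp add: A_def)
    have AT'_int: "integrable (R \<Otimes>\<^sub>M R) (\<lambda>x. A x * T' x)"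
      and AT'_0: "(\<integral>x. A x * T' x \<partial>(R \<Otimes>\<^sub>M R)) = 0"
      using RR.integrable_product_swap[OF AT_int] AT_0
        RR.integral_product_swap[of "\<lambda>x. A x * case_prod T x"]
      by (simp_all add: T'_def split_beta' A_swap)
    have T'_sq: "integrable (R \<Otimes>\<^sub>M R) (\<lambda>x. (T' x)\<^sup>2)"
      and T'_eq: "(\<integral>x. (T' x)\<^sup>2 \<partial>(R \<Otimes>\<^sub>M R)) = (\<integral>x. (case_prod T x)\<^sup>2 \<partial>(R \<Otimes>\<^sub>M R))"
      using RR.integrable_product_swap[OF T_sq]
        RR.integral_product_swap[of "\<lambda>x. (case_prod T x)\<^sup>2"]
      by (simp_all add: T'_def split_beta')
    have T_val: "ennreal (\<integral>x. (case_prod T x)\<^sup>2 \<partial>(R \<Otimes>\<^sub>M R)) = ennreal (card I) * b"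
      using T_nn nn_integral_eq_integral[OF T_sq] by simp
    \<comment> \<open>Only the product of the two correction sums is estimated, by
      \<open>2 * t * t' \<le> t\<^sup>2 + t'\<^sup>2\<close>. The products with \<open>A\<close> are
      kept exactly, since they integrate to 0. As \<open>?F\<close> dominates a square, it is
      nonnegative, and its two kinds of integral agree.\<close>
    let ?F = "\<lambda>x. (A x)\<^sup>2 - 2 * (A x * T' x) - 2 * (A x * case_prod T x)
                + 2 * (T' x)\<^sup>2 + 2 * (case_prod T x)\<^sup>2"
    have bound: "(a - t' - t)\<^sup>2 \<le> a\<^sup>2 - 2 * (a * t') - 2 * (a * t) + 2 * t'\<^sup>2 + 2 * t\<^sup>2" for a t t' :: real
      using sum_squares_bound[of t t'] by (simp add: power2_eq_square algebra_simps)
    have F_int: "integrable (R \<Otimes>\<^sub>M R) ?F"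
      using A_sq AT'_int AT_int T'_sq T_sq by simp
    have F_val: "(\<integral>x. ?F x \<partial>(R \<Otimes>\<^sub>M R))
        = 2 * card I * (\<integral>z. (s z)\<^sup>2 \<partial>Q) + 4 * (\<integral>x. (case_prod T x)\<^sup>2 \<partial>(R \<Otimes>\<^sub>M R))"
      using A_sq AT'_int AT_int T'_sq T_sq AT_0 AT'_0 T'_eq by simp
    have "(\<integral>\<^sup>+x. ennreal ((A x - T' x - case_prod T x)\<^sup>2) \<partial>(R \<Otimes>\<^sub>M R)) \<le> (\<integral>\<^sup>+x. ennreal (?F x) \<partial>(R \<Otimes>\<^sub>M R))"
      by (intro nn_integral_mono ennreal_leI bound)
    also have "\<dots> = ennreal (\<integral>x. ?F x \<partial>(R \<Otimes>\<^sub>M R))"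
      using F_int by (intro nn_integral_eq_integral AE_I2 order_trans[OF zero_le_power2 bound])
    also have "\<dots> = ennreal (2 * card I) * ennreal (\<integral>z. (s z)\<^sup>2 \<partial>Q) + ennreal (4 * card I) * b"
      unfolding F_val
      by (simp add: ennreal_plus ennreal_mult T_val mult.assoc)
    finally show ?thesis
      unfolding b_def R_def[symmetric]
      by (simp add: A_def T'_def S_def T_def split_beta')
  qed
qed

section \<open>The joint law of state and action\<close>

locale design = xi: prob_space xi + lam: sigma_finite_measure lam
  for xi :: "'x measure" and lam :: "'a measure" +
  fixes p :: "'x \<Rightarrow> 'a \<Rightarrow> real"
  assumes p_meas[measurable]: "case_prod p \<in> borel_measurable (xi \<Otimes>\<^sub>M lam)"
    and p_pos: "x \<in> space xi \<Longrightarrow> a \<in> space lam \<Longrightarrow> p x a > 0"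
    and p_1: "x \<in> space xi \<Longrightarrow> (\<integral>\<^sup>+ a. ennreal (p x a) \<partial>lam) = 1"
begin

sublocale pair_sigma_finite xi lam ..

definition law :: "('x \<times> 'a) measure" where
  "law = density (xi \<Otimes>\<^sub>M lam) (\<lambda>(x, a). ennreal (p x a))"

lemma sets_law[measurable_cong, simp]: "sets law = sets (xi \<Otimes>\<^sub>M lam)"
  by (simp add: law_def)

lemma space_law[simp]: "space law = space xi \<times> space lam"
  by (simp add: law_def space_pair_measure)

lemma nn_integral_law:
  assumes [measurable]: "f \<in> borel_measurable (xi \<Otimes>\<^sub>M lam)"
  shows "(\<integral>\<^sup>+z. f z \<partial>law) = (\<integral>\<^sup>+x. \<integral>\<^sup>+a. ennreal (p x a) * f (x, a) \<partial>lam \<partial>xi)"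
  unfolding law_def by (simp add: nn_integral_density lam.nn_integral_fst[symmetric])

text \<open>Each \<open>p x\<close> has total mass 1, so integrating out the action leaves
  \<open>xi\<close>. Hence \<open>law\<close> is a probability measure too.\<close>

lemma distr_law_fst: "distr law xi fst = xi"
proof (rule measure_eqI)
  fix E assume E: "E \<in> sets (distr law xi fst)"
  then have [measurable]: "E \<in> sets xi" by simp
  have "emeasure (distr law xi fst) E = (\<integral>\<^sup>+z. indicator E (fst z) \<partial>law)"
    by (subst nn_integral_distr[of fst law xi "indicator E", symmetric]) simp_all
  also have "\<dots> = (\<integral>\<^sup>+x. indicator E x \<partial>xi)"
  proof (subst nn_integral_law)
    show "(\<integral>\<^sup>+x. \<integral>\<^sup>+a. ennreal (p x a) * indicator E (fst (x, a)) \<partial>lam \<partial>xi) = (\<integral>\<^sup>+x. indicator E x \<partial>xi)"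
      by (rule nn_integral_cong) (simp add: nn_integral_multc p_1)
  qed measurable
  finally show "emeasure (distr law xi fst) E = emeasure xi E" by simp
qed simp

lemma prob_space_law: "prob_space law"
  using xi.prob_space_axioms prob_space_distrD[of fst law xi] by (simp add: distr_law_fst)

sublocale law: prob_space law by (rule prob_space_law)

lemma
  fixes f :: "'x \<Rightarrow> real"
  assumes "f \<in> borel_measurable xi"
  shows integrable_law_fst: "integrable law (\<lambda>z. f (fst z)) \<longleftrightarrow> integrable xi f"
    and integral_law_fst: "(\<integral>z. f (fst z) \<partial>law) = (\<integral>x. f x \<partial>xi)"
  using assms integrable_distr_eq[of fst law xi f] integral_distr[of fst law xi f]
  by (simp_all add: distr_law_fst)

lemma
  fixes f :: "'x \<times> 'a \<Rightarrow> real"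
  assumes "f \<in> borel_measurable (xi \<Otimes>\<^sub>M lam)"
  shows integrable_law: "integrable law f \<longleftrightarrow> integrable (xi \<Otimes>\<^sub>M lam) (\<lambda>(x, a). p x a * f (x, a))"
    and integral_law: "(\<integral>z. f z \<partial>law) = (\<integral>z. (case z of (x, a) \<Rightarrow> p x a * f (x, a)) \<partial>(xi \<Otimes>\<^sub>M lam))"
proof -
  have *: "law = density (xi \<Otimes>\<^sub>M lam) (\<lambda>z. ennreal (case_prod p z))"
    by (simp add: law_def split_beta')
  have nn: "AE z in xi \<Otimes>\<^sub>M lam. 0 \<le> case_prod p z"
    by (auto intro!: AE_I2 less_imp_le p_pos simp: space_pair_measure)
  show "integrable law f \<longleftrightarrow> integrable (xi \<Otimes>\<^sub>M lam) (\<lambda>(x, a). p x a * f (x, a))"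
    unfolding * by (subst integrable_density[OF assms p_meas nn]) (simp add: split_beta')
  show "(\<integral>z. f z \<partial>law) = (\<integral>z. (case z of (x, a) \<Rightarrow> p x a * f (x, a)) \<partial>(xi \<Otimes>\<^sub>M lam))"
    unfolding * by (subst integral_density[OF assms p_meas nn]) (simp add: split_beta')
qed

text \<open>The conditional mean of \<open>G\<close> at \<open>(X, A)\<close> given
  \<open>X = x\<close>. Where \<open>p x a * G x a\<close> is not integrable in \<open>a\<close>,
  the value is the default 0.\<close>

definition action_mean :: "('x \<Rightarrow> 'a \<Rightarrow> real) \<Rightarrow> 'x \<Rightarrow> real" where
  "action_mean G x = (LINT a|lam. p x a * G x a)"

lemma action_mean_measurable[measurable]:
  assumes [measurable]: "case_prod G \<in> borel_measurable (xi \<Otimes>\<^sub>M lam)"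
  shows "action_mean G \<in> borel_measurable xi"
  unfolding action_mean_def[abs_def] by measurable

text \<open>For fixed \<open>x\<close> this says that a variance is at most the second moment, under
  the density \<open>p x\<close>; if the second moment is infinite, there is nothing to prove. It is
  here that a conditional variance is replaced by the weighted norm of the final bound.\<close>

lemma nn_integral_action_centered_le:
  assumes [measurable]: "case_prod G \<in> borel_measurable (xi \<Otimes>\<^sub>M lam)"
  shows "(\<integral>\<^sup>+(x, a). ennreal ((G x a - action_mean G x)\<^sup>2) \<partial>law) \<le> (\<integral>\<^sup>+(x, a). ennreal ((G x a)\<^sup>2) \<partial>law)"
proof -
  have "(\<integral>\<^sup>+a. ennreal (p x a) * ennreal ((G x a - action_mean G x)\<^sup>2) \<partial>lam)
      \<le> (\<integral>\<^sup>+a. ennreal (p x a) * ennreal ((G x a)\<^sup>2) \<partial>lam)" if x: "x \<in> space xi" for x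
  proof -
    let ?D = "density lam (\<lambda>a. ennreal (p x a))"
    have [measurable]: "p x \<in> borel_measurable lam" "G x \<in> borel_measurable lam"
      using x by measurable
    interpret D: prob_space ?D
      by (rule prob_spaceI) (use x in \<open>simp add: emeasure_density p_1 cong: nn_integral_cong\<close>)
    have mean: "action_mean G x = D.expectation (G x)"
      using x p_pos[OF x] by (simp add: integral_density action_mean_def AE_I2 less_imp_le)
    have "(\<integral>\<^sup>+a. ennreal ((G x a - action_mean G x)\<^sup>2) \<partial>?D) \<le> (\<integral>\<^sup>+a. ennreal ((G x a)\<^sup>2) \<partial>?D)"
    proof (cases "integrable ?D (\<lambda>a. (G x a)\<^sup>2)")
      case True
      then have G1: "integrable ?D (G x)"
        by (rule D.square_integrable_imp_integrable[rotated]) simp_all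
      have int: "integrable ?D (\<lambda>a. (G x a - action_mean G x)\<^sup>2)"
        using True G1 by (simp add: power2_diff)
      have "D.variance (G x) \<le> D.expectation (\<lambda>a. (G x a)\<^sup>2)"
        using D.variance_eq[OF G1 True] by simp
      then show ?thesis
        using True int by (simp add: nn_integral_eq_integral mean ennreal_leI)
    next
      case False
      then have "(\<integral>\<^sup>+a. ennreal ((G x a)\<^sup>2) \<partial>?D) = \<infinity>"
        by (subst (asm) integrable_square_iff) (auto simp: less_top[symmetric])
      then show ?thesis by simp
    qed
    then show ?thesis
      by (simp add: nn_integral_density)
  qed
  then show ?thesis
    by (subst (1 2) nn_integral_law) (simp_all add: nn_integral_mono)
qed

text \<open>Given the state, \<open>f x\<close> is a constant and \<open>G\<close> minus its
  conditional mean integrates to 0. Square integrability of both factors makes the product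
  integrable under \<open>law\<close>, so that the integral may be computed state by state.\<close>

lemma integral_action_centered_mult:
  assumes [measurable]: "case_prod G \<in> borel_measurable (xi \<Otimes>\<^sub>M lam)" "f \<in> borel_measurable xi"
    and G: "integrable law (\<lambda>(x, a). (G x a)\<^sup>2)" and f: "integrable xi (\<lambda>x. (f x)\<^sup>2)"
  shows "(\<integral>(x, a). f x * (G x a - action_mean G x) \<partial>law) = 0"
proof -
  have G': "(\<integral>\<^sup>+(x, a). ennreal ((G x a)\<^sup>2) \<partial>law) < \<infinity>"
    using G integrable_square_iff[of "case_prod G" law] by (simp add: split_beta')
  then have "integrable law (\<lambda>z. (G (fst z) (snd z) - action_mean G (fst z))\<^sup>2)"
    using le_less_trans[OF nn_integral_action_centered_le[OF assms(1)] G']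
    by (subst integrable_square_iff) (simp_all add: split_beta')
  then have int: "integrable law (\<lambda>z. f (fst z) * (G (fst z) (snd z) - action_mean G (fst z)))"
    using f integrable_law_fst[of "\<lambda>x. (f x)\<^sup>2"] by (intro integrable_mult_of_squares) simp_all
  have "integrable law (case_prod G)"
    using G[unfolded split_beta'] law.square_integrable_imp_integrable[of "case_prod G"] by (simp add: split_beta')
  then have "integrable (xi \<Otimes>\<^sub>M lam) (\<lambda>(x, a). p x a * G x a)"
    by (subst (asm) integrable_law) (simp_all add: split_beta')
  \<comment> \<open>For almost every \<open>x\<close> the section is integrable, so
    \<open>action_mean G x\<close> is a genuine mean and not the default value.\<close>
  from AE_integrable_fst[OF this]
  have "AE x in xi. (\<integral>a. p x a * (f x * (G x a - action_mean G x)) \<partial>lam) = 0"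
    using AE_space
  proof eventually_elim
    case (elim x)
    then have x: "x \<in> space xi" by simp
    have [measurable]: "p x \<in> borel_measurable lam"
      using x by measurable
    have nn: "AE a in lam. 0 \<le> p x a"
      using p_pos[OF x] by (intro AE_I2 less_imp_le)
    have p: "integrable lam (p x)" "(\<integral>a. p x a \<partial>lam) = 1"
      using p_1[OF x] nn by (simp_all add: integrableI_nonneg integral_eq_nn_integral)
    have "(\<integral>a. p x a * (f x * (G x a - action_mean G x)) \<partial>lam)
        = (\<integral>a. f x * (p x a * G x a - action_mean G x * p x a) \<partial>lam)"
      by (simp add: algebra_simps)
    also have "\<dots> = 0"
      using elim p by (simp add: action_mean_def)
    finally show ?case .
  qed
  then have "(\<integral>x. \<integral>a. p x a * (f x * (G x a - action_mean G x)) \<partial>lam \<partial>xi) = 0"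
    by (rule integral_eq_zero_AE)
  moreover have "(\<integral>x. \<integral>a. p x a * (f x * (G x a - action_mean G x)) \<partial>lam \<partial>xi)
      = (\<integral>(x, a). f x * (G x a - action_mean G x) \<partial>law)"
    using int by (subst integral_fst) (auto simp: integrable_law integral_law split_beta')
  ultimately show ?thesis by simp
qed

end

text \<open>The factor \<open>f (X, A)\<close> is measurable for the sigma-algebra generated by
  \<open>(X, A)\<close>, so it can be moved out of conditional expectations. The conditional
  variance then gives the second moment, and the conditional mean gives the centering.\<close>

lemma
  fixes f w :: "'x \<times> 'a \<Rightarrow> real"
  assumes M: "prob_space M"
    and obs: "observation_model M xi lam p mu sigma2 X A Y"
    and mu: "case_prod mu \<in> borel_measurable (xi \<Otimes>\<^sub>M lam)"
    and s2: "case_prod sigma2 \<in> borel_measurable (xi \<Otimes>\<^sub>M lam)"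
    and f: "f \<in> borel_measurable (xi \<Otimes>\<^sub>M lam)"
  shows observation_noise_second_moment:
      "(\<integral>\<^sup>+\<omega>. ennreal ((f (X \<omega>, A \<omega>) * (Y \<omega> - mu (X \<omega>) (A \<omega>)))\<^sup>2) \<partial>M) =
       (\<integral>\<^sup>+(x, a). ennreal (p x a) * (ennreal ((f (x, a))\<^sup>2) * ennreal (sigma2 x a)) \<partial>(xi \<Otimes>\<^sub>M lam))"
    and observation_noise_centered:
      "integrable M (\<lambda>\<omega>. f (X \<omega>, A \<omega>) * (Y \<omega> - mu (X \<omega>) (A \<omega>))) \<Longrightarrow>
       (\<integral>\<omega>. f (X \<omega>, A \<omega>) * (Y \<omega> - mu (X \<omega>) (A \<omega>)) \<partial>M) = 0"
proof -
  interpret M: prob_space M by fact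
  define F where "F = vimage_algebra (space M) (\<lambda>\<omega>. (X \<omega>, A \<omega>)) (xi \<Otimes>\<^sub>M lam)"
  have D: "distributed M (xi \<Otimes>\<^sub>M lam) (\<lambda>\<omega>. (X \<omega>, A \<omega>)) (\<lambda>(x, a). ennreal (p x a))"
    and Y: "integrable M Y"
    and E: "AE \<omega> in M. real_cond_exp M F Y \<omega> = mu (X \<omega>) (A \<omega>)"
    and V: "AE \<omega> in M. nn_cond_exp M F (\<lambda>\<omega>. ennreal ((Y \<omega> - mu (X \<omega>) (A \<omega>))\<^sup>2)) \<omega> =
              ennreal (sigma2 (X \<omega>) (A \<omega>))"
    using obs by (auto simp: observation_model_def Let_def F_def)
  have XA[measurable]: "(\<lambda>\<omega>. (X \<omega>, A \<omega>)) \<in> measurable M (xi \<Otimes>\<^sub>M lam)"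
    using D by (rule distributed_measurable)
  have XA_F: "(\<lambda>\<omega>. (X \<omega>, A \<omega>)) \<in> measurable F (xi \<Otimes>\<^sub>M lam)"
    unfolding F_def using measurable_space[OF XA] by (intro measurable_vimage_algebra1) blast
  have "subalgebra M F"
    unfolding subalgebra_def F_def using measurable_sets[OF XA] measurable_space[OF XA]
    by (auto simp: sets_vimage_algebra2)
  then interpret finite_measure_subalgebra M F by unfold_locales
  have f_F: "(\<lambda>\<omega>. f (X \<omega>, A \<omega>)) \<in> borel_measurable F"
    using measurable_compose[OF XA_F f] .
  have mu_F: "(\<lambda>\<omega>. mu (X \<omega>) (A \<omega>)) \<in> borel_measurable F"
    using measurable_compose[OF XA_F mu] by simp
  have [measurable]: "Y \<in> borel_measurable M" using Y by simp
  have mu_M[measurable]: "(\<lambda>\<omega>. mu (X \<omega>) (A \<omega>)) \<in> borel_measurable M"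
    using measurable_compose[OF XA mu] by simp
  note [measurable] = f s2
  have "(\<integral>\<^sup>+\<omega>. ennreal ((f (X \<omega>, A \<omega>) * (Y \<omega> - mu (X \<omega>) (A \<omega>)))\<^sup>2) \<partial>M)
      = (\<integral>\<^sup>+\<omega>. ennreal ((f (X \<omega>, A \<omega>))\<^sup>2) * ennreal ((Y \<omega> - mu (X \<omega>) (A \<omega>))\<^sup>2) \<partial>M)"
    by (simp add: power_mult_distrib ennreal_mult)
  also have "\<dots> = (\<integral>\<^sup>+\<omega>. ennreal ((f (X \<omega>, A \<omega>))\<^sup>2) *
      nn_cond_exp M F (\<lambda>\<omega>. ennreal ((Y \<omega> - mu (X \<omega>) (A \<omega>))\<^sup>2)) \<omega> \<partial>M)"
    using f_F by (intro nn_cond_exp_intg[symmetric]) simp_all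
  also have "\<dots> = (\<integral>\<^sup>+\<omega>. ennreal ((f (X \<omega>, A \<omega>))\<^sup>2) * ennreal (sigma2 (X \<omega>) (A \<omega>)) \<partial>M)"
    using V by (intro nn_integral_cong_AE) auto
  also have "\<dots> = (\<integral>\<^sup>+z. ennreal ((f z)\<^sup>2) * ennreal (case_prod sigma2 z)
      \<partial>distr M (xi \<Otimes>\<^sub>M lam) (\<lambda>\<omega>. (X \<omega>, A \<omega>)))"
    by (subst nn_integral_distr) simp_all
  also have "\<dots> = (\<integral>\<^sup>+(x, a). ennreal (p x a) * (ennreal ((f (x, a))\<^sup>2) * ennreal (sigma2 x a)) \<partial>(xi \<Otimes>\<^sub>M lam))"
    using distributed_borel_measurable[OF D]
    by (simp add: distributed_distr_eq_density[OF D] nn_integral_density split_beta')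
  finally show "(\<integral>\<^sup>+\<omega>. ennreal ((f (X \<omega>, A \<omega>) * (Y \<omega> - mu (X \<omega>) (A \<omega>)))\<^sup>2) \<partial>M) =
      (\<integral>\<^sup>+(x, a). ennreal (p x a) * (ennreal ((f (x, a))\<^sup>2) * ennreal (sigma2 x a)) \<partial>(xi \<Otimes>\<^sub>M lam))" .
  assume int: "integrable M (\<lambda>\<omega>. f (X \<omega>, A \<omega>) * (Y \<omega> - mu (X \<omega>) (A \<omega>)))"
  \<comment> \<open>\<open>f(X, A) Y\<close> itself need not be integrable, so \<open>Y\<close> is centered before conditioning.\<close>
  have mu_int: "integrable M (\<lambda>\<omega>. mu (X \<omega>) (A \<omega>))"
    using real_cond_exp_int(1)[OF Y] E
    by (subst integrable_cong_AE[where g = "real_cond_exp M F Y"]) auto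
  have "AE \<omega> in M. real_cond_exp M F (\<lambda>\<omega>. Y \<omega> - mu (X \<omega>) (A \<omega>)) \<omega> = 0"
    using real_cond_exp_diff[OF Y mu_int] real_cond_exp_F_meas[OF mu_int mu_F] E by auto
  then have "(\<integral>\<omega>. f (X \<omega>, A \<omega>) * real_cond_exp M F (\<lambda>\<omega>. Y \<omega> - mu (X \<omega>) (A \<omega>)) \<omega> \<partial>M) = 0"
    by (intro integral_eq_zero_AE) auto
  then show "(\<integral>\<omega>. f (X \<omega>, A \<omega>) * (Y \<omega> - mu (X \<omega>) (A \<omega>)) \<partial>M) = 0"
    using real_cond_exp_intg(2)[OF int f_F] by simp
qed

section \<open>Score and correction of one observation\<close>

text \<open>A single observation is fixed here. Under identical distribution it represents the whole
  sample, which enters only in the final argument.\<close>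

locale observation = design xi lam p + M: prob_space M
  for M :: "'w measure" and xi :: "'x measure" and lam :: "'a measure" and p :: "'x \<Rightarrow> 'a \<Rightarrow> real" +
  fixes g mu sigma2 :: "'x \<Rightarrow> 'a \<Rightarrow> real"
    and X :: "'w \<Rightarrow> 'x" and A :: "'w \<Rightarrow> 'a" and Y :: "'w \<Rightarrow> real"
  assumes g_meas[measurable]: "case_prod g \<in> borel_measurable (xi \<Otimes>\<^sub>M lam)"
    and mu_meas[measurable]: "case_prod mu \<in> borel_measurable (xi \<Otimes>\<^sub>M lam)"
    and sigma2_meas[measurable]: "case_prod sigma2 \<in> borel_measurable (xi \<Otimes>\<^sub>M lam)"
    and sigma2_nonneg: "x \<in> space xi \<Longrightarrow> a \<in> space lam \<Longrightarrow> sigma2 x a \<ge> 0"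
    and g_mu_integrable: "integrable (xi \<Otimes>\<^sub>M lam) (\<lambda>(x, a). g x a * mu x a)"
    and model: "observation_model M xi lam p mu sigma2 X A Y"
begin

section \<open>Transfer of integrals between \<open>M\<close>, \<open>law\<close> and
  \<open>xi\<close>\<close>

lemma XA_meas[measurable]: "(\<lambda>\<omega>. (X \<omega>, A \<omega>)) \<in> measurable M (xi \<Otimes>\<^sub>M lam)"
  and distr_XA: "distr M (xi \<Otimes>\<^sub>M lam) (\<lambda>\<omega>. (X \<omega>, A \<omega>)) = law"
  and Y_meas[measurable]: "Y \<in> borel_measurable M"
  using model distributed_measurable[of M "xi \<Otimes>\<^sub>M lam" "\<lambda>\<omega>. (X \<omega>, A \<omega>)"]
    distributed_distr_eq_density[of M "xi \<Otimes>\<^sub>M lam" "\<lambda>\<omega>. (X \<omega>, A \<omega>)"]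
  by (auto simp: observation_model_def law_def)

lemma X_meas[measurable]: "X \<in> measurable M xi"
  and A_meas[measurable]: "A \<in> measurable M lam"
  using measurable_compose[OF XA_meas measurable_fst] measurable_compose[OF XA_meas measurable_snd]
  by simp_all

lemma nn_integral_XA:
  "f \<in> borel_measurable (xi \<Otimes>\<^sub>M lam) \<Longrightarrow> (\<integral>\<^sup>+\<omega>. f (X \<omega>, A \<omega>) \<partial>M) = (\<integral>\<^sup>+z. f z \<partial>law)"
  using nn_integral_distr[OF XA_meas, of f] by (simp add: distr_XA)

lemma
  fixes f :: "'x \<times> 'a \<Rightarrow> real"
  assumes "f \<in> borel_measurable (xi \<Otimes>\<^sub>M lam)"
  shows integrable_XA: "integrable M (\<lambda>\<omega>. f (X \<omega>, A \<omega>)) \<longleftrightarrow> integrable law f"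
    and integral_XA: "(\<integral>\<omega>. f (X \<omega>, A \<omega>) \<partial>M) = (\<integral>z. f z \<partial>law)"
  using integrable_distr_eq[OF XA_meas assms] integral_distr[OF XA_meas assms]
  by (simp_all add: distr_XA)

lemma AE_X: "AE x in xi. P x \<Longrightarrow> AE \<omega> in M. P (X \<omega>)"
proof -
  assume "AE x in xi. P x"
  then have "AE x in distr law xi fst. P x" unfolding distr_law_fst .
  then have "AE z in law. P (fst z)" by (rule AE_distrD[rotated]) simp
  then have "AE z in distr M (xi \<Otimes>\<^sub>M lam) (\<lambda>\<omega>. (X \<omega>, A \<omega>)). P (fst z)" unfolding distr_XA .
  from AE_distrD[OF XA_meas this] show ?thesis by simp
qed

text \<open>Because \<open>p * (g * k / p)\<^sup>2 = g\<^sup>2 / p * k\<^sup>2\<close>, the weighted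
  norm is an ordinary L2 norm under \<open>law\<close>, namely that of the reweighted function
  \<open>g * k / p\<close>.\<close>

lemma weighted_norm_sq_eq:
  assumes [measurable]: "case_prod k \<in> borel_measurable (xi \<Otimes>\<^sub>M lam)"
  shows "weighted_norm_sq xi lam p g k = (\<integral>\<^sup>+(x, a). ennreal ((g x a * k x a / p x a)\<^sup>2) \<partial>law)"
proof -
  have "weighted_norm_sq xi lam p g k = (\<integral>\<^sup>+x. \<integral>\<^sup>+a. ennreal ((g x a)\<^sup>2 / p x a * (k x a)\<^sup>2) \<partial>lam \<partial>xi)"
    unfolding weighted_norm_sq_def by (rule Fubini') simp
  also have "\<dots> = (\<integral>\<^sup>+x. \<integral>\<^sup>+a. ennreal (p x a) * ennreal ((g x a * k x a / p x a)\<^sup>2) \<partial>lam \<partial>xi)"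
  proof (intro nn_integral_cong)
    fix x a assume "x \<in> space xi" "a \<in> space lam"
    then show "ennreal ((g x a)\<^sup>2 / p x a * (k x a)\<^sup>2)
        = ennreal (p x a) * ennreal ((g x a * k x a / p x a)\<^sup>2)"
      using p_pos[of x a]
      by (simp add: ennreal_mult[symmetric] power_mult_distrib power_divide power2_eq_square)
  qed
  also have "\<dots> = (\<integral>\<^sup>+(x, a). ennreal ((g x a * k x a / p x a)\<^sup>2) \<partial>law)"
    by (subst nn_integral_law) simp_all
  finally show ?thesis .
qed

text \<open>For almost every \<open>x\<close> this is the conditional mean of
  \<open>g * mu / p\<close> at \<open>(X, A)\<close> given \<open>X = x\<close>; averaging it over
  \<open>xi\<close> gives the target.\<close>

definition cond_target :: "'x \<Rightarrow> real" where
  "cond_target x = inner_lam lam (g x) (mu x)"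

lemma inner_lam_measurable[measurable]:
  assumes [measurable]: "case_prod h \<in> borel_measurable (xi \<Otimes>\<^sub>M lam)"
  shows "(\<lambda>x. inner_lam lam (g x) (h x)) \<in> borel_measurable xi"
  unfolding inner_lam_def by measurable

lemma cond_target_meas[measurable]: "cond_target \<in> borel_measurable xi"
  unfolding cond_target_def[abs_def] by measurable

lemma
  shows cond_target_integrable: "integrable xi cond_target"
    and target_eq: "target xi lam g mu = (\<integral>x. cond_target x \<partial>xi)"
  using integrable_fst[OF g_mu_integrable] Fubini_integral[OF g_mu_integrable]
  by (simp_all add: cond_target_def[abs_def] inner_lam_def target_def)

text \<open>
  Only almost everywhere: \<open>inner_lam\<close> splits linearly only at those \<open>x\<close> where both Bochner integrals
  exist, and is \<open>0\<close> where they do not.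
\<close>

lemma f_hat_diff:
  assumes [measurable]: "case_prod h \<in> borel_measurable (xi \<Otimes>\<^sub>M lam)"
    and fin: "weighted_norm_sq xi lam p g (\<lambda>x a. h x a - mu x a) < \<infinity>"
  defines "G \<equiv> \<lambda>x a. g x a * (h x a - mu x a) / p x a"
  shows "AE x in xi. \<forall>a\<in>space lam.
    f_hat lam p g h x a - f_hat lam p g mu x a = G x a - action_mean G x"
proof -
  have [measurable]: "case_prod G \<in> borel_measurable (xi \<Otimes>\<^sub>M lam)"
    unfolding G_def by measurable
  have "integrable law (\<lambda>z. (case_prod G z)\<^sup>2)"
    using fin by (subst integrable_square_iff) (simp_all add: weighted_norm_sq_eq G_def split_beta')
  then have "integrable law (case_prod G)"
    by (rule law.square_integrable_imp_integrable[rotated]) simp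
  then have "integrable (xi \<Otimes>\<^sub>M lam) (\<lambda>(x, a). p x a * G x a)"
    by (subst (asm) integrable_law) simp_all
  from AE_integrable_fst[OF this] AE_integrable_fst[OF g_mu_integrable] show ?thesis
    using AE_space
  proof eventually_elim
    case (elim x)
    have pG: "p x a * G x a = g x a * (h x a - mu x a)" if "a \<in> space lam" for a
      using p_pos[OF elim(3) that] by (simp add: G_def)
    have "integrable lam (\<lambda>a. g x a * (h x a - mu x a))"
      using elim(1) pG by (simp cong: Bochner_Integration.integrable_cong)
    \<comment> \<open>The function \<open>h\<close> is split as \<open>(h - mu) + mu\<close>. On
      this section the first part is integrable against \<open>g x\<close> by the finite norm and
      the second by the assumption on \<open>g * mu\<close>.\<close>
    then have "(\<integral>a. g x a * (h x a - mu x a) + g x a * mu x a \<partial>lam)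
        = (\<integral>a. g x a * (h x a - mu x a) \<partial>lam) + (\<integral>a. g x a * mu x a \<partial>lam)"
      using elim(2) by (rule Bochner_Integration.integral_add)
    moreover have "action_mean G x = (\<integral>a. g x a * (h x a - mu x a) \<partial>lam)"
      unfolding action_mean_def using pG by (intro Bochner_Integration.integral_cong) auto
    ultimately have "action_mean G x = inner_lam lam (g x) (h x) - inner_lam lam (g x) (mu x)"
      by (simp add: inner_lam_def algebra_simps)
    then show ?case
      by (simp add: f_hat_def G_def diff_divide_distrib algebra_simps)
  qed
qed

section \<open>The law of one observation, and the noise and deviation that make up its
  score\<close>

definition obs_law :: "('x \<times> 'a \<times> real) measure" where
  "obs_law = distr M (obs_space xi lam) (\<lambda>\<omega>. (X \<omega>, A \<omega>, Y \<omega>))"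

text \<open>The efficient influence function of the target.\<close>

definition score :: "'x \<times> 'a \<times> real \<Rightarrow> real" where
  "score = (\<lambda>(x, a, y). g x a / p x a * (y - mu x a) + (cond_target x - target xi lam g mu))"

text \<open>The error made in \<open>f_hat\<close> by using \<open>h\<close> in place of
  \<open>mu\<close>. It is taken as a function of the whole observation so that it can be paired
  with \<open>score\<close> under \<open>obs_law\<close>.\<close>

definition correction :: "('x \<Rightarrow> 'a \<Rightarrow> real) \<Rightarrow> 'x \<times> 'a \<times> real \<Rightarrow> real" where
  "correction h = (\<lambda>(x, a, y). f_hat lam p g h x a - f_hat lam p g mu x a)"

lemma sets_obs_law[measurable_cong, simp]: "sets obs_law = sets (obs_space xi lam)"
  by (simp add: obs_law_def)

lemma prob_space_obs_law: "prob_space obs_law"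
  unfolding obs_law_def by (rule M.prob_space_distr) simp

lemma score_meas[measurable]: "score \<in> borel_measurable (obs_space xi lam)"
  unfolding score_def by measurable

lemma correction_meas[measurable]:
  assumes [measurable]: "case_prod h \<in> borel_measurable (xi \<Otimes>\<^sub>M lam)"
  shows "correction h \<in> borel_measurable (obs_space xi lam)"
  unfolding correction_def f_hat_def by measurable

definition noise :: "'w \<Rightarrow> real" where
  "noise \<omega> = g (X \<omega>) (A \<omega>) / p (X \<omega>) (A \<omega>) * (Y \<omega> - mu (X \<omega>) (A \<omega>))"

definition deviation :: "'x \<Rightarrow> real" where
  "deviation x = cond_target x - target xi lam g mu"

lemma noise_meas[measurable]: "noise \<in> borel_measurable M"
  unfolding noise_def[abs_def] by measurable

lemma deviation_meas[measurable]: "deviation \<in> borel_measurable xi"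
  unfolding deviation_def[abs_def] by measurable

lemma score_eq: "score (X \<omega>, A \<omega>, Y \<omega>) = noise \<omega> + deviation (X \<omega>)"
  by (simp add: score_def noise_def deviation_def)

text \<open>The target is the mean of \<open>cond_target\<close>, so the first summand of the
  efficient variance is the second moment of \<open>deviation\<close>. The second is that of
  \<open>noise\<close>, by conditioning on \<open>(X, A)\<close> and
  \<open>g\<^sup>2 / p = p * (g / p)\<^sup>2\<close>.\<close>

lemma efficient_variance_eq:
  "efficient_variance xi lam p g mu sigma2
     = (\<integral>\<^sup>+x. ennreal ((deviation x)\<^sup>2) \<partial>xi) + (\<integral>\<^sup>+\<omega>. ennreal ((noise \<omega>)\<^sup>2) \<partial>M)"
proof -
  have "(\<integral>\<^sup>+ a. (\<integral>\<^sup>+ x. ennreal ((g x a)\<^sup>2 / p x a * sigma2 x a) \<partial>xi) \<partial>lam)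
      = (\<integral>\<^sup>+(x, a). ennreal ((g x a)\<^sup>2 / p x a * sigma2 x a) \<partial>(xi \<Otimes>\<^sub>M lam))"
    using nn_integral_snd[of "\<lambda>(x, a). ennreal ((g x a)\<^sup>2 / p x a * sigma2 x a)"] by simp
  also have "\<dots> = (\<integral>\<^sup>+(x, a). ennreal (p x a) * (ennreal ((g x a / p x a)\<^sup>2) * ennreal (sigma2 x a)) \<partial>(xi \<Otimes>\<^sub>M lam))"
  proof (intro nn_integral_cong, clarsimp simp: space_pair_measure)
    fix x a assume "x \<in> space xi" "a \<in> space lam"
    then show "ennreal ((g x a)\<^sup>2 * sigma2 x a / p x a)
        = ennreal (p x a) * (ennreal ((g x a / p x a)\<^sup>2) * ennreal (sigma2 x a))"
      using p_pos[of x a] sigma2_nonneg[of x a]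
      by (simp add: ennreal_mult[symmetric] power_divide power2_eq_square)
  qed
  also have "\<dots> = (\<integral>\<^sup>+\<omega>. ennreal ((noise \<omega>)\<^sup>2) \<partial>M)"
    using observation_noise_second_moment[OF M.prob_space_axioms model mu_meas sigma2_meas,
        of "\<lambda>(x, a). g x a / p x a"] by (simp add: noise_def)
  finally show ?thesis
    by (simp add: efficient_variance_def ext_variance_def deviation_def target_eq cond_target_def)
qed

section \<open>Moments of score and correction when the efficient variance is finite\<close>

context
  assumes fin: "efficient_variance xi lam p g mu sigma2 < \<infinity>"
begin

lemma noise_square_integrable: "integrable M (\<lambda>\<omega>. (noise \<omega>)\<^sup>2)"
  and deviation_square_integrable: "integrable xi (\<lambda>x. (deviation x)\<^sup>2)"
  using fin efficient_variance_eq by (auto simp: integrable_square_iff)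

lemma deviation_XA_square_integrable: "integrable M (\<lambda>\<omega>. (deviation (X \<omega>))\<^sup>2)"
  using deviation_square_integrable integrable_law_fst[of "\<lambda>x. (deviation x)\<^sup>2"]
    integrable_XA[of "\<lambda>z. (deviation (fst z))\<^sup>2"] by simp

lemma integral_deviation: "(\<integral>x. deviation x \<partial>xi) = 0"
  using cond_target_integrable by (simp add: deviation_def[abs_def] target_eq xi.prob_space)

text \<open>The noise has conditional mean 0 given \<open>(X, A)\<close>; two square integrable
  factors make the product integrable. It serves with \<open>f\<close> the deviation, the constant 1
  and the centered correction.\<close>

lemma integral_noise_mult:
  assumes [measurable]: "f \<in> borel_measurable (xi \<Otimes>\<^sub>M lam)"
    and "integrable M (\<lambda>\<omega>. (f (X \<omega>, A \<omega>))\<^sup>2)"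
  shows "(\<integral>\<omega>. noise \<omega> * f (X \<omega>, A \<omega>) \<partial>M) = 0"
proof -
  have "integrable M (\<lambda>\<omega>. noise \<omega> * f (X \<omega>, A \<omega>))"
    using noise_square_integrable assms by (intro integrable_mult_of_squares) simp_all
  then show ?thesis
    using observation_noise_centered[OF M.prob_space_axioms model mu_meas sigma2_meas,
        of "\<lambda>(x, a). g x a / p x a * f (x, a)"]
    by (simp add: noise_def ac_simps)
qed

text \<open>The score is noise plus deviation. The two are orthogonal and each is centered, so the
  second moments add up.\<close>

lemma
  shows score_square_integrable: "integrable obs_law (\<lambda>z. (score z)\<^sup>2)"
    and score_second_moment: "ennreal (\<integral>z. (score z)\<^sup>2 \<partial>obs_law) = efficient_variance xi lam p g mu sigma2"
    and score_centered: "(\<integral>z. score z \<partial>obs_law) = 0"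
proof -
  have orth: "(\<integral>\<omega>. noise \<omega> * deviation (X \<omega>) \<partial>M) = 0"
    using integral_noise_mult[of "\<lambda>z. deviation (fst z)"] deviation_XA_square_integrable by simp
  have sq: "integrable M (\<lambda>\<omega>. (noise \<omega> + deviation (X \<omega>))\<^sup>2)"
    using noise_square_integrable deviation_XA_square_integrable
    by (intro integrable_square_add) simp_all
  then show "integrable obs_law (\<lambda>z. (score z)\<^sup>2)"
    by (simp add: obs_law_def integrable_distr_eq score_eq)
  have "(\<integral>z. (score z)\<^sup>2 \<partial>obs_law) = (\<integral>\<omega>. (noise \<omega> + deviation (X \<omega>))\<^sup>2 \<partial>M)"
    by (simp add: obs_law_def integral_distr score_eq)
  also have "\<dots> = (\<integral>\<omega>. (noise \<omega>)\<^sup>2 \<partial>M) + (\<integral>\<omega>. (deviation (X \<omega>))\<^sup>2 \<partial>M)"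
    using noise_square_integrable deviation_XA_square_integrable orth
    by (intro integral_square_add_orthogonal) simp_all
  also have "(\<integral>\<omega>. (deviation (X \<omega>))\<^sup>2 \<partial>M) = (\<integral>x. (deviation x)\<^sup>2 \<partial>xi)"
    using integral_XA[of "\<lambda>z. (deviation (fst z))\<^sup>2"] integral_law_fst[of "\<lambda>x. (deviation x)\<^sup>2"] by simp
  finally show "ennreal (\<integral>z. (score z)\<^sup>2 \<partial>obs_law) = efficient_variance xi lam p g mu sigma2"
    using noise_square_integrable deviation_square_integrable
    by (simp add: efficient_variance_eq nn_integral_eq_integral ennreal_plus add.commute)
  have "integrable M noise" "integrable M (\<lambda>\<omega>. deviation (X \<omega>))"
    using M.square_integrable_imp_integrable[OF _ noise_square_integrable]
      M.square_integrable_imp_integrable[OF _ deviation_XA_square_integrable] by simp_all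
  moreover have "(\<integral>\<omega>. deviation (X \<omega>) \<partial>M) = 0"
    using integral_XA[of "\<lambda>z. deviation (fst z)"] integral_law_fst[of deviation] integral_deviation
    by simp
  moreover have "(\<integral>\<omega>. noise \<omega> \<partial>M) = 0"
    using integral_noise_mult[of "\<lambda>_. 1"] by simp
  ultimately show "(\<integral>z. score z \<partial>obs_law) = 0"
    by (simp add: obs_law_def integral_distr score_eq)
qed

text \<open>Almost surely the correction equals \<open>D\<close>, a function of state and action
  with conditional mean 0 given the state. It is orthogonal to the noise because it depends on
  \<open>(X, A)\<close> alone, and to the deviation because the latter depends on \<open>X\<close>
  alone.\<close>

lemma
  assumes h[measurable]: "case_prod h \<in> borel_measurable (xi \<Otimes>\<^sub>M lam)"
    and norm: "weighted_norm_sq xi lam p g (\<lambda>x a. h x a - mu x a) < \<infinity>"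
  shows correction_second_moment_le:
      "(\<integral>\<^sup>+z. ennreal ((correction h z)\<^sup>2) \<partial>obs_law) \<le> weighted_norm_sq xi lam p g (\<lambda>x a. h x a - mu x a)"
    and correction_centered: "(\<integral>z. correction h z \<partial>obs_law) = 0"
    and correction_orthogonal: "(\<integral>z. score z * correction h z \<partial>obs_law) = 0"
proof -
  define G where "G x a = g x a * (h x a - mu x a) / p x a" for x a
  define D where "D = (\<lambda>(x, a). G x a - action_mean G x)"
  have G_meas[measurable]: "case_prod G \<in> borel_measurable (xi \<Otimes>\<^sub>M lam)"
    unfolding G_def[abs_def] by measurable
  have D_meas[measurable]: "D \<in> borel_measurable (xi \<Otimes>\<^sub>M lam)"
    unfolding D_def by measurable
  have "AE x in xi. \<forall>a\<in>space lam. f_hat lam p g h x a - f_hat lam p g mu x a = D (x, a)"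
    using f_hat_diff[OF h norm] by (simp add: D_def G_def[abs_def])
  from AE_X[OF this] have eq: "AE \<omega> in M. correction h (X \<omega>, A \<omega>, Y \<omega>) = D (X \<omega>, A \<omega>)"
    using AE_space
    by eventually_elim (use measurable_space[OF A_meas] in \<open>simp add: correction_def\<close>)
  have G_nn: "weighted_norm_sq xi lam p g (\<lambda>x a. h x a - mu x a) = (\<integral>\<^sup>+(x, a). ennreal ((G x a)\<^sup>2) \<partial>law)"
    by (simp add: weighted_norm_sq_eq G_def)
  have D_nn: "(\<integral>\<^sup>+z. ennreal ((D z)\<^sup>2) \<partial>law) \<le> (\<integral>\<^sup>+(x, a). ennreal ((G x a)\<^sup>2) \<partial>law)"
    using nn_integral_action_centered_le[OF G_meas] by (simp add: D_def split_beta')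
  have G_sq: "integrable law (\<lambda>(x, a). (G x a)\<^sup>2)"
    using norm integrable_square_iff[of "case_prod G" law] by (simp add: G_nn split_beta')
  have D_sq: "integrable law (\<lambda>z. (D z)\<^sup>2)"
    using le_less_trans[OF D_nn] norm by (simp add: integrable_square_iff G_nn)
  then have DM_sq: "integrable M (\<lambda>\<omega>. (D (X \<omega>, A \<omega>))\<^sup>2)"
    by (subst integrable_XA[of "\<lambda>z. (D z)\<^sup>2"]) simp_all
  have "(\<integral>\<^sup>+z. ennreal ((correction h z)\<^sup>2) \<partial>obs_law) = (\<integral>\<^sup>+\<omega>. ennreal ((D (X \<omega>, A \<omega>))\<^sup>2) \<partial>M)"
    unfolding obs_law_def using eq
    by (subst nn_integral_distr) (auto intro!: nn_integral_cong_AE elim!: eventually_mono)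
  also have "\<dots> \<le> weighted_norm_sq xi lam p g (\<lambda>x a. h x a - mu x a)"
    using D_nn by (simp add: G_nn nn_integral_XA[of "\<lambda>z. ennreal ((D z)\<^sup>2)"])
  finally show "(\<integral>\<^sup>+z. ennreal ((correction h z)\<^sup>2) \<partial>obs_law) \<le> weighted_norm_sq xi lam p g (\<lambda>x a. h x a - mu x a)" .
  have "(\<integral>z. correction h z \<partial>obs_law) = (\<integral>\<omega>. D (X \<omega>, A \<omega>) \<partial>M)"
    unfolding obs_law_def using eq by (subst integral_distr) (auto intro!: integral_cong_AE)
  also have "\<dots> = 0"
    using integral_action_centered_mult[OF G_meas _ G_sq, of "\<lambda>_. 1"]
      integral_XA[OF D_meas] by (simp add: D_def split_beta')
  finally show "(\<integral>z. correction h z \<partial>obs_law) = 0" .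
  have "(\<integral>z. score z * correction h z \<partial>obs_law)
      = (\<integral>\<omega>. noise \<omega> * D (X \<omega>, A \<omega>) + deviation (X \<omega>) * D (X \<omega>, A \<omega>) \<partial>M)"
    unfolding obs_law_def using eq
    by (subst integral_distr) (auto intro!: integral_cong_AE elim!: eventually_mono simp: score_eq distrib_right)
  also have "\<dots> = (\<integral>\<omega>. noise \<omega> * D (X \<omega>, A \<omega>) \<partial>M) + (\<integral>\<omega>. deviation (X \<omega>) * D (X \<omega>, A \<omega>) \<partial>M)"
    using noise_square_integrable deviation_XA_square_integrable DM_sq
    by (intro Bochner_Integration.integral_add integrable_mult_of_squares) simp_all
  also have "\<dots> = 0"
    using integral_noise_mult[OF D_meas DM_sq]
      integral_action_centered_mult[OF G_meas deviation_meas G_sq deviation_square_integrable]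
      integral_XA[of "\<lambda>z. deviation (fst z) * D z"]
    by (simp add: D_def split_beta')
  finally show "(\<integral>z. score z * correction h z \<partial>obs_law) = 0" .
qed

end

end

section \<open>The two halves of the sample\<close>

text \<open>Variables with disjoint index sets are independent, and each block has a product law.
  Reindexing the second block turns its law into that of the first, so the pair of halves has law
  \<open>R \<Otimes>\<^sub>M R\<close>.\<close>

lemma
  fixes Z :: "nat \<Rightarrow> 'w \<Rightarrow> 'z"
  assumes M: "prob_space M" and n: "n \<ge> 2" "even n"
    and ind: "prob_space.indep_vars M (\<lambda>_. N) Z {1..n}"
    and Q: "\<And>i. i \<in> {1..n} \<Longrightarrow> distr M N (Z i) = Q"
  defines "R \<equiv> PiM {1..n div 2} (\<lambda>_. Q)"
  shows halves_measurable: "(\<lambda>\<omega>. (half1 n (\<lambda>i. Z i \<omega>), half2 n (\<lambda>i. Z i \<omega>))) \<in> measurable M (R \<Otimes>\<^sub>M R)"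
    and distr_halves: "distr M (R \<Otimes>\<^sub>M R) (\<lambda>\<omega>. (half1 n (\<lambda>i. Z i \<omega>), half2 n (\<lambda>i. Z i \<omega>))) = R \<Otimes>\<^sub>M R"
    and distr_half1: "distr M R (\<lambda>\<omega>. half1 n (\<lambda>i. Z i \<omega>)) = R"
proof -
  interpret M: prob_space M by fact
  define m where "m = n div 2"
  have m: "n = 2 * m" "m > 0" using n by (auto simp: m_def)
  have Z_meas: "Z i \<in> measurable M N" if "i \<in> {1..n}" for i
    using ind that by (auto simp: M.indep_vars_def)
  have prob_Q: "prob_space Q"
    using M.prob_space_distr[OF Z_meas[of 1]] Q[of 1] n by auto
  have sets_Q: "sets Q = sets N" using Q[of 1] n by auto
  let ?N = "\<lambda>J. PiM J (\<lambda>_. N)" and ?Q = "\<lambda>J. PiM J (\<lambda>_. Q)"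
  have sets_NQ: "sets (?N J) = sets (?Q J)" for J :: "nat set"
    using sets_Q by (intro sets_PiM_cong) auto
  have law: "distr M (?Q J) (\<lambda>\<omega>. \<lambda>i\<in>J. Z i \<omega>) = ?Q J" if "J \<subseteq> {1..n}" "J \<noteq> {}" for J
  proof -
    have "distr M (?N J) (\<lambda>\<omega>. \<lambda>i\<in>J. Z i \<omega>) = PiM J (\<lambda>i. distr M N (Z i))"
      using M.indep_vars_iff_distr_eq_PiM'[where I = J and M' = "\<lambda>_. N" and X = Z, OF that(2) Z_meas]
        M.indep_vars_subset[OF ind that(1)] that(1) by blast
    moreover have "PiM J (\<lambda>i. distr M N (Z i)) = ?Q J"
      using that Q by (intro PiM_cong) auto
    ultimately show ?thesis
      using distr_cong[of M M "?N J" "?Q J" "\<lambda>\<omega>. \<lambda>i\<in>J. Z i \<omega>" "\<lambda>\<omega>. \<lambda>i\<in>J. Z i \<omega>"] sets_NQ by simp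
  qed
  \<comment> \<open>The second block carries the indices \<open>m + 1\<close> to
    \<open>2 * m\<close>; \<open>shift\<close> moves them to \<open>1\<close> up to
    \<open>m\<close>, as \<open>half2\<close> does.\<close>
  define shift where "shift w = (\<lambda>i\<in>{1..m}. w (m + i))" for w :: "nat \<Rightarrow> 'z"
  have shift_meas: "shift \<in> measurable (?Q {m+1..n}) R"
    unfolding shift_def[abs_def] R_def m_def[symmetric]
    by (intro measurable_restrict measurable_component_singleton) (use m in auto)
  have H1: "(\<lambda>\<omega>. half1 n (\<lambda>i. Z i \<omega>)) = (\<lambda>\<omega>. \<lambda>i\<in>{1..m}. Z i \<omega>)"
    by (simp add: half1_def m_def)
  have H2: "(\<lambda>\<omega>. half2 n (\<lambda>i. Z i \<omega>)) = shift \<circ> (\<lambda>\<omega>. \<lambda>i\<in>{m+1..n}. Z i \<omega>)"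
    using m by (auto simp: half2_def m_def[symmetric] shift_def fun_eq_iff)
  have Z_restrict: "(\<lambda>\<omega>. \<lambda>i\<in>J. Z i \<omega>) \<in> measurable M (?Q J)" if "J \<subseteq> {1..n}" for J
    using Z_meas that by (intro measurable_restrict) (auto cong: measurable_cong_sets simp: sets_Q)
  show half1: "distr M R (\<lambda>\<omega>. half1 n (\<lambda>i. Z i \<omega>)) = R"
    unfolding H1 R_def m_def[symmetric] by (rule law) (use m in auto)
  have "distr M R (\<lambda>\<omega>. half2 n (\<lambda>i. Z i \<omega>)) = distr (distr M (?Q {m+1..n}) (\<lambda>\<omega>. \<lambda>i\<in>{m+1..n}. Z i \<omega>)) R shift"
    unfolding H2 by (rule distr_distr[symmetric, OF shift_meas]) (rule Z_restrict, auto)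
  also have "\<dots> = distr (?Q {m+1..n}) R shift"
    using m by (subst law) auto
  also have "\<dots> = R"
    using distr_PiM_reindex[of "{m+1..n}" "\<lambda>_. Q" "\<lambda>i. m + i" "{1..m}"] m prob_Q
    by (simp add: R_def m_def[symmetric] shift_def[abs_def] inj_on_def)
  finally have half2: "distr M R (\<lambda>\<omega>. half2 n (\<lambda>i. Z i \<omega>)) = R" .
  have "M.indep_var (?N {1..m}) (\<lambda>\<omega>. \<lambda>i\<in>{1..m}. Z i \<omega>) (?N {m+1..n}) (\<lambda>\<omega>. \<lambda>i\<in>{m+1..n}. Z i \<omega>)"
    by (rule M.indep_var_restrict[OF ind]) (use m in auto)
  then have "M.indep_var R (id \<circ> (\<lambda>\<omega>. \<lambda>i\<in>{1..m}. Z i \<omega>)) R (shift \<circ> (\<lambda>\<omega>. \<lambda>i\<in>{m+1..n}. Z i \<omega>))"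
  proof (rule M.indep_var_compose)
    show "id \<in> measurable (?N {1..m}) R"
      unfolding R_def m_def[symmetric] by (rule measurable_ident_sets[folded id_def]) (rule sets_NQ)
    show "shift \<in> measurable (?N {m+1..n}) R"
      using shift_meas by (subst measurable_cong_sets[OF sets_NQ refl])
  qed
  then have "M.indep_var R (\<lambda>\<omega>. half1 n (\<lambda>i. Z i \<omega>)) R (\<lambda>\<omega>. half2 n (\<lambda>i. Z i \<omega>))"
    by (simp add: H1 H2)
  then show "distr M (R \<Otimes>\<^sub>M R) (\<lambda>\<omega>. (half1 n (\<lambda>i. Z i \<omega>), half2 n (\<lambda>i. Z i \<omega>))) = R \<Otimes>\<^sub>M R"
    and "(\<lambda>\<omega>. (half1 n (\<lambda>i. Z i \<omega>), half2 n (\<lambda>i. Z i \<omega>))) \<in> measurable M (R \<Otimes>\<^sub>M R)"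
    unfolding M.indep_var_distribution_eq by (simp_all add: half1 half2 measurable_Pair)
qed

section \<open>Decomposition of the estimation error and the final bound\<close>

context observation
begin

text \<open>A pointwise identity: \<open>f_hat\<close> at \<open>mu\<close> is
  \<open>g * mu / p\<close> minus \<open>cond_target\<close>, so each summand of the estimator is
  score minus correction plus target. The \<open>n\<close> copies of the target, divided by
  \<open>n\<close>, cancel.\<close>

lemma tau_hat_minus_target:
  assumes n: "n \<ge> 2" "even n"
  shows "tau_hat lam p g est n z - target xi lam g mu =
    1 / real n * ((\<Sum>i\<in>{1..n div 2}. score (half1 n z i)) + (\<Sum>i\<in>{1..n div 2}. score (half2 n z i))
      - (\<Sum>i\<in>{1..n div 2}. correction (est (half2 n z)) (half1 n z i))
      - (\<Sum>i\<in>{1..n div 2}. correction (est (half1 n z)) (half2 n z i)))"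
proof -
  define m where "m = n div 2"
  have m: "n = 2 * m" "m > 0" using n by (auto simp: m_def)
  have summand: "(case w of (x, a, y) \<Rightarrow> g x a / p x a * y - f_hat lam p g h x a)
      = score w - correction h w + target xi lam g mu" for w h
    by (cases w) (simp add: score_def correction_def f_hat_def cond_target_def diff_divide_distrib algebra_simps)
  have shift: "(\<Sum>i\<in>{m + 1..n}. f (z i)) = (\<Sum>i\<in>{1..m}. f (half2 n z i))" for f :: "_ \<Rightarrow> real"
    using sum.shift_bounds_cl_nat_ivl[of "\<lambda>i. f (z i)" 1 m m] m
    by (simp add: half2_def mult_2 add.commute)
  have first: "(\<Sum>i\<in>{1..m}. f (z i)) = (\<Sum>i\<in>{1..m}. f (half1 n z i))" for f :: "_ \<Rightarrow> real"
    using m by (intro sum.cong) (auto simp: half1_def)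
  have "tau_hat lam p g est n z =
    1 / real n * ((\<Sum>i\<in>{1..m}. score (half1 n z i)) + (\<Sum>i\<in>{1..m}. score (half2 n z i))
      - (\<Sum>i\<in>{1..m}. correction (est (half2 n z)) (half1 n z i))
      - (\<Sum>i\<in>{1..m}. correction (est (half1 n z)) (half2 n z i))
      + real n * target xi lam g mu)"
    unfolding tau_hat_def m_def[symmetric] summand sum.distrib sum_subtractf
      first[of score] first[of "correction _"] shift[of score] shift[of "correction _"]
    using m by (simp add: algebra_simps)
  then show ?thesis
    using m by (simp add: m_def[symmetric] algebra_simps)
qed

end

theorem theorem1:
  fixes M :: "'w measure" and xi :: "'x measure" and lam :: "'a measure"
    and p g mu sigma2 :: "'x \<Rightarrow> 'a \<Rightarrow> real"
    and X :: "nat \<Rightarrow> 'w \<Rightarrow> 'x" and A :: "nat \<Rightarrow> 'w \<Rightarrow> 'a" and Y :: "nat \<Rightarrow> 'w \<Rightarrow> real"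
    and est :: "(nat \<Rightarrow> 'x \<times> 'a \<times> real) \<Rightarrow> 'x \<Rightarrow> 'a \<Rightarrow> real"
    and n :: nat
  defines "Z \<equiv> \<lambda>i \<omega>. (X i \<omega>, A i \<omega>, Y i \<omega>)"
  assumes "n \<ge> 2" and "even n"
    and "prob_space M" and "prob_space xi" and "sigma_finite_measure lam"
    and "case_prod p \<in> borel_measurable (xi \<Otimes>\<^sub>M lam)"
    and "\<And>x a. x \<in> space xi \<Longrightarrow> a \<in> space lam \<Longrightarrow> p x a > 0"
    and "\<And>x. x \<in> space xi \<Longrightarrow> (\<integral>\<^sup>+ a. ennreal (p x a) \<partial>lam) = 1"
    and "case_prod g \<in> borel_measurable (xi \<Otimes>\<^sub>M lam)"
    and "case_prod mu \<in> borel_measurable (xi \<Otimes>\<^sub>M lam)"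
    and "case_prod sigma2 \<in> borel_measurable (xi \<Otimes>\<^sub>M lam)"
    and "\<And>x a. x \<in> space xi \<Longrightarrow> a \<in> space lam \<Longrightarrow> sigma2 x a \<ge> 0"
    and "integrable (xi \<Otimes>\<^sub>M lam) (\<lambda>(x, a). g x a * mu x a)"
    and "prob_space.indep_vars M (\<lambda>_. obs_space xi lam) Z {1..n}"
    and "\<And>i j. i \<in> {1..n} \<Longrightarrow> j \<in> {1..n} \<Longrightarrow>
           distr M (obs_space xi lam) (Z i) = distr M (obs_space xi lam) (Z j)"
    and "\<And>i. i \<in> {1..n} \<Longrightarrow> observation_model M xi lam p mu sigma2 (X i) (A i) (Y i)"
    and "estimation_procedure xi lam (n div 2) est"
  shows "(\<integral>\<^sup>+ \<omega>. ennreal (\<bar>tau_hat lam p g est n (\<lambda>i. Z i \<omega>) - target xi lam g mu\<bar>\<^sup>2) \<partial>M)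
    \<le> ennreal (1 / real n) *
        (efficient_variance xi lam p g mu sigma2 +
         2 * (\<integral>\<^sup>+ \<omega>. weighted_norm_sq xi lam p g
                 (\<lambda>x a. est (half1 n (\<lambda>i. Z i \<omega>)) x a - mu x a) \<partial>M))"
proof -
  interpret M: prob_space M by fact
  interpret xi: prob_space xi by fact
  interpret lam: sigma_finite_measure lam by fact
  \<comment> \<open>Any index will do as the representative observation, since all
    \<open>Z i\<close> have the same law.\<close>
  obtain j where j: "j \<in> {1..n}" using assms(2) by fastforce
  interpret O: observation M xi lam p g mu sigma2 "X j" "A j" "Y j"
    using assms j by unfold_locales auto
  define Q where "Q = O.obs_law"
  define m where "m = n div 2"
  define R where "R = PiM {1..m} (\<lambda>_. Q)"
  have m: "n = 2 * m" "m > 0" using assms by (auto simp: m_def)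
  have Q: "distr M (obs_space xi lam) (Z i) = Q" if "i \<in> {1..n}" for i
    using assms(16)[OF that j] by (simp add: Q_def O.obs_law_def Z_def)
  interpret Q: prob_space Q unfolding Q_def by (rule O.prob_space_obs_law)
  interpret R: prob_space R unfolding R_def by (rule prob_space_PiM) (rule Q.prob_space_axioms)
  interpret RR: pair_prob_space R R ..
  have sets_Q[measurable_cong]: "sets Q = sets (obs_space xi lam)" by (simp add: Q_def)
  have est: "(\<lambda>(d, x, a). est d x a) \<in> borel_measurable (R \<Otimes>\<^sub>M (xi \<Otimes>\<^sub>M lam))"
  proof -
    have "sets R = sets (\<Pi>\<^sub>M i\<in>{1..m}. obs_space xi lam)"
      unfolding R_def by (intro sets_PiM_cong) (simp_all add: sets_Q)
    then show ?thesis
      using assms(18) unfolding estimation_procedure_def m_def[symmetric]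
      by (simp cong: measurable_cong_sets sets_pair_measure_cong)
  qed
  have est_comp[measurable (raw)]: "(\<lambda>w. est (f w) (h w) (k w)) \<in> borel_measurable N"
    if "f \<in> measurable N R" "h \<in> measurable N xi" "k \<in> measurable N lam" for N f h k
    using measurable_compose[OF measurable_Pair[OF that(1) measurable_Pair[OF that(2,3)]] est] by simp
  define H where "H \<omega> = (half1 n (\<lambda>i. Z i \<omega>), half2 n (\<lambda>i. Z i \<omega>))" for \<omega>
  have H_meas: "H \<in> measurable M (R \<Otimes>\<^sub>M R)"
    unfolding R_def m_def H_def[abs_def] by (rule halves_measurable[OF assms(4,2,3,15)]) (rule Q)
  have distr_H: "distr M (R \<Otimes>\<^sub>M R) H = R \<Otimes>\<^sub>M R"
    unfolding R_def m_def H_def[abs_def] by (rule distr_halves[OF assms(4,2,3,15)]) (rule Q)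
  have distr_fst_H: "distr M R (\<lambda>\<omega>. fst (H \<omega>)) = R"
    unfolding R_def m_def H_def fst_conv by (rule distr_half1[OF assms(4,2,3,15)]) (rule Q)
  define norm where "norm d = weighted_norm_sq xi lam p g (\<lambda>x a. est d x a - mu x a)" for d
  \<comment> \<open>In this form the norm is a single integral over \<open>law\<close> with the
    sample \<open>d\<close> as a parameter, which shows that it is measurable in
    \<open>d\<close>.\<close>
  have norm_eq: "norm d = (\<integral>\<^sup>+z. ennreal ((g (fst z) (snd z) * (est d (fst z) (snd z) - mu (fst z) (snd z)) / p (fst z) (snd z))\<^sup>2) \<partial>O.law)"
    if "d \<in> space R" for d
    unfolding norm_def using that by (subst O.weighted_norm_sq_eq) (simp_all add: split_beta')
  have norm_meas: "norm \<in> borel_measurable R"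
    by (subst measurable_cong[OF norm_eq]) simp_all
  have norm_half1: "(\<integral>\<^sup>+\<omega>. norm (fst (H \<omega>)) \<partial>M) = (\<integral>\<^sup>+d. norm d \<partial>R)"
    using nn_integral_distr[OF measurable_compose[OF H_meas measurable_fst], of norm] norm_meas
    by (simp add: distr_fst_H)
  define V where "V = efficient_variance xi lam p g mu sigma2"
  define B where "B = (\<integral>\<^sup>+d. norm d \<partial>R)"
  define K where "K = (\<lambda>(d1, d2). (\<Sum>i\<in>{1..m}. O.score (d1 i)) + (\<Sum>i\<in>{1..m}. O.score (d2 i))
      - (\<Sum>i\<in>{1..m}. O.correction (est d2) (d1 i)) - (\<Sum>i\<in>{1..m}. O.correction (est d1) (d2 i)))"
  have corr_meas[measurable]: "(\<lambda>(d, z). O.correction (est d) z) \<in> borel_measurable (R \<Otimes>\<^sub>M Q)"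
    unfolding O.correction_def f_hat_def inner_lam_def by measurable
  have score_Q[measurable]: "O.score \<in> borel_measurable Q"
    using O.score_meas by (simp cong: measurable_cong_sets add: sets_Q)
  note [measurable del] = O.score_meas O.correction_meas
  have [measurable]: "i \<in> {1..m} \<Longrightarrow> (\<lambda>d. d i) \<in> measurable R Q" for i
    unfolding R_def by simp
  have K_meas[measurable]: "K \<in> borel_measurable (R \<Otimes>\<^sub>M R)"
    unfolding K_def by measurable
  have "(\<integral>\<^sup>+ \<omega>. ennreal (\<bar>tau_hat lam p g est n (\<lambda>i. Z i \<omega>) - target xi lam g mu\<bar>\<^sup>2) \<partial>M)
      = (\<integral>\<^sup>+\<omega>. ennreal ((1 / real n)\<^sup>2) * ennreal ((K (H \<omega>))\<^sup>2) \<partial>M)"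
    unfolding H_def O.tau_hat_minus_target[OF assms(2,3)] K_def m_def
    by (simp add: ennreal_mult[symmetric] power_mult_distrib power_divide)
  also have "\<dots> = (\<integral>\<^sup>+d. ennreal ((1 / real n)\<^sup>2) * ennreal ((K d)\<^sup>2) \<partial>(R \<Otimes>\<^sub>M R))"
    using nn_integral_distr[OF H_meas, of "\<lambda>d. ennreal ((1 / real n)\<^sup>2) * ennreal ((K d)\<^sup>2)"]
    by (simp add: distr_H)
  also have "\<dots> = ennreal ((1 / real n)\<^sup>2) * (\<integral>\<^sup>+d. ennreal ((K d)\<^sup>2) \<partial>(R \<Otimes>\<^sub>M R))"
    by (rule nn_integral_cmult) measurable
  finally have lhs: "(\<integral>\<^sup>+ \<omega>. ennreal (\<bar>tau_hat lam p g est n (\<lambda>i. Z i \<omega>) - target xi lam g mu\<bar>\<^sup>2) \<partial>M)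
      = ennreal ((1 / real n)\<^sup>2) * (\<integral>\<^sup>+d. ennreal ((K d)\<^sup>2) \<partial>(R \<Otimes>\<^sub>M R))" .
  have "\<dots> \<le> ennreal (1 / real n) * (V + 2 * B)"
  \<comment> \<open>If either term is infinite, the bound is infinite because \<open>1 / n\<close>
    is positive. Otherwise the moment results for score and correction apply.\<close>
  proof (cases "V < \<infinity> \<and> B < \<infinity>")
    case False
    then have top: "V + 2 * B = \<infinity>"
      by (auto simp: less_top[symmetric] ennreal_mult_top)
    show ?thesis
      unfolding top using m by (simp add: ennreal_mult_top)
  next
    case True
    then have V: "efficient_variance xi lam p g mu sigma2 < \<infinity>" by (simp add: V_def)
    \<comment> \<open>A finite expected norm makes the norm finite for almost every sample, which is
      the condition for the correction to be centered and orthogonal to the score.\<close>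
    have "AE d in R. norm d \<noteq> \<infinity>"
      using True by (intro nn_integral_PInf_AE norm_meas) (auto simp: B_def)
    then have good: "AE d in R. (\<integral>\<^sup>+z. ennreal ((O.correction (est d) z)\<^sup>2) \<partial>Q) \<le> norm d \<and>
        integrable Q (\<lambda>z. (O.correction (est d) z)\<^sup>2) \<and> (\<integral>z. O.correction (est d) z \<partial>Q) = 0 \<and>
        (\<integral>z. O.score z * O.correction (est d) z \<partial>Q) = 0"
      using AE_space
    proof eventually_elim
      case (elim d)
      have d: "case_prod (est d) \<in> borel_measurable (xi \<Otimes>\<^sub>M lam)"
        using elim by measurable
      have fin: "weighted_norm_sq xi lam p g (\<lambda>x a. est d x a - mu x a) < \<infinity>"
        using elim by (simp add: norm_def less_top[symmetric])
      have le: "(\<integral>\<^sup>+z. ennreal ((O.correction (est d) z)\<^sup>2) \<partial>Q) \<le> norm d"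
        using O.correction_second_moment_le[OF V d fin] by (simp add: Q_def norm_def)
      then have "integrable Q (\<lambda>z. (O.correction (est d) z)\<^sup>2)"
        using O.correction_meas[OF d] le_less_trans[OF le] fin
        by (subst integrable_square_iff) (simp_all add: norm_def measurable_cong_sets[OF sets_Q refl])
      then show ?case
        using le O.correction_centered[OF V d fin] O.correction_orthogonal[OF V d fin]
        by (simp add: Q_def)
    qed
    have "(\<integral>\<^sup>+d. ennreal ((K d)\<^sup>2) \<partial>(R \<Otimes>\<^sub>M R))
        \<le> ennreal (2 * card {1..m}) * ennreal (\<integral>z. (O.score z)\<^sup>2 \<partial>Q)
          + ennreal (4 * card {1..m}) * (\<integral>\<^sup>+d. \<integral>\<^sup>+z. ennreal ((O.correction (est d) z)\<^sup>2) \<partial>Q \<partial>R)"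
      using crossfit_second_moment[of Q "{1..m}" O.score "\<lambda>d. O.correction (est d)", folded R_def,
          OF Q.prob_space_axioms finite_atLeastAtMost score_Q
            O.score_square_integrable[OF V, folded Q_def] O.score_centered[OF V, folded Q_def]
            corr_meas eventually_mono[OF good]]
      by (simp add: K_def split_beta')
    \<comment> \<open>Each half has \<open>m\<close> observations, and \<open>2 * m = n\<close>,
      \<open>4 * m = 2 * n\<close>. The common factor \<open>n\<close> then cancels against one of
      the two factors \<open>1 / n\<close>.\<close>
    also have "\<dots> \<le> ennreal n * V + ennreal n * (2 * B)"
    proof (intro add_mono)
      show "ennreal (2 * card {1..m}) * ennreal (\<integral>z. (O.score z)\<^sup>2 \<partial>Q) \<le> ennreal n * V"
        using O.score_second_moment[OF V] m by (simp add: Q_def V_def)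
      have "(\<integral>\<^sup>+d. \<integral>\<^sup>+z. ennreal ((O.correction (est d) z)\<^sup>2) \<partial>Q \<partial>R) \<le> B"
        unfolding B_def using good by (intro nn_integral_mono_AE) auto
      moreover have "ennreal (4 * card {1..m}) = ennreal n * 2"
        using m by (simp add: ennreal_mult[symmetric] flip: ennreal_numeral)
      ultimately show "ennreal (4 * card {1..m}) * (\<integral>\<^sup>+d. \<integral>\<^sup>+z. ennreal ((O.correction (est d) z)\<^sup>2) \<partial>Q \<partial>R)
          \<le> ennreal n * (2 * B)"
        by (simp add: mult.assoc mult_left_mono)
    qed
    finally have "ennreal ((1 / real n)\<^sup>2) * (\<integral>\<^sup>+d. ennreal ((K d)\<^sup>2) \<partial>(R \<Otimes>\<^sub>M R))
        \<le> ennreal ((1 / real n)\<^sup>2) * (ennreal n * (V + 2 * B))"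
      by (intro mult_left_mono) (simp_all add: distrib_left)
    also have "\<dots> = ennreal (1 / real n) * (V + 2 * B)"
      using m by (simp add: mult.assoc[symmetric] ennreal_mult[symmetric] power2_eq_square)
    finally show ?thesis .
  qed
  then show ?thesis
    unfolding lhs V_def B_def norm_half1[symmetric] norm_def H_def fst_conv .
qed

end
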